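(* Let $\mathbb{E}$ be a finitely complete category. The following conditions are equivalent: 1) for every object $Y$ of $\mathbb{E}$, the (pointed) fibre $\mathsf{Pt}_Y\mathbb{E}$ of the fibration of points is unital; 2) every relation $(f,g)\colon R\rightarrowtail X\times Y$ in $\mathbb{E}$ is difunctional; 3) $\mathbb{E}$ is a Mal'tsev category; 4) for every object $Y$ of $\mathbb{E}$, the fibre $\mathsf{Pt}_Y\mathbb{E}$ is strongly unital.
   Context: For an object $Y$ of $\mathbb{E}$, $\mathsf{Pt}_Y\mathbb{E}$ is the category whose objects are split epimorphisms with a given section $(f\colon X\to Y,\ s\colon Y\to X)$, $fs=1_Y$, and whose morphisms $(f,s)\to(f',s')$ are morphisms $x\colon X\to X'$ of $\mathbb{E}$ with $f'x=f$ and $xs=s'$. It is pointed (zero object $(1_Y,1_Y)$) and finitely complete. A Mal'tsev category is a finitely complete category in which every (internal) reflexive relation is an equivalence relation. A relation $(f,g)\colon R\rightarrowtail X\times Y$ (a subobject of $X\times Y$) is difunctional if, for all generalized elements (i.e. after applying every $\mathrm{Hom}(T,-)$), $xRu$, $yRu$ and $yRv$ imply $xRv$. A category is unital if it is pointed, finitely complete, and for every pair of objects $(X,Y)$ the monomorphisms $(1_X,0)\colon X\rightarrowtail X\times Y$ and $(0,1_Y)\colon Y\rightarrowtail X\times Y$ are jointly extremally epic (any monomorphism into $X\times Y$ through which both factor is an isomorphism). A category is strongly unital if it is pointed, finitely complete, and every reflexive relation $R\rightarrowtail X\times X$ on an object $X$ which is right punctual, i.e. such that $(0,1_X)\colon X\rightarrowtail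 X\times X$ factors through $R$, is the largest equivalence relation $\nabla_X=X\times X$. *)

theory Defs
  imports Main
begin

section \<open>Categories, functors and finite limits\<close>

record ('o, 'a) cat =
  Obj :: "'o set"
  Arr :: "'a set"
  dom :: "'a \<Rightarrow> 'o"
  cod :: "'a \<Rightarrow> 'o"
  ident :: "'o \<Rightarrow> 'a"
  comp :: "'a \<Rightarrow> 'a \<Rightarrow> 'a"  (infixl \<open>\<cdot>\<index>\<close> 70)

text \<open>Composition is applicative: \<open>g \<cdot> f\<close> is \<open>g\<close> after \<open>f\<close>. All operations are total functions
  that are only meaningful on objects, arrows, and composable pairs of arrows.\<close>

definition hom :: "('o, 'a) cat \<Rightarrow> 'o \<Rightarrow> 'o \<Rightarrow> 'a set" where
  "hom C X Y = {f \<in> Arr C. dom C f = X \<and> cod C f = Y}"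

locale category =
  fixes C :: "('o, 'a) cat" (structure)
  assumes dom_obj: "f \<in> Arr C \<Longrightarrow> dom C f \<in> Obj C"
    and cod_obj: "f \<in> Arr C \<Longrightarrow> cod C f \<in> Obj C"
    and ident_hom: "X \<in> Obj C \<Longrightarrow> ident C X \<in> hom C X X"
    and comp_hom: "f \<in> hom C X Y \<Longrightarrow> g \<in> hom C Y Z \<Longrightarrow> g \<cdot> f \<in> hom C X Z"
    and comp_ident_left: "f \<in> hom C X Y \<Longrightarrow> ident C Y \<cdot> f = f"
    and comp_ident_right: "f \<in> hom C X Y \<Longrightarrow> f \<cdot> ident C X = f"
    and comp_assoc: "f \<in> hom C W X \<Longrightarrow> g \<in> hom C X Y \<Longrightarrow> h \<in> hom C Y Z
          \<Longrightarrow> h \<cdot> (g \<cdot> f) = (h \<cdot> g) \<cdot> f"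

definition "functor" ::
    "('j, 'k) cat \<Rightarrow> ('o, 'a) cat \<Rightarrow> ('j \<Rightarrow> 'o) \<Rightarrow> ('k \<Rightarrow> 'a) \<Rightarrow> bool" where
  "functor J C Fo Fa \<longleftrightarrow>
     (\<forall>j \<in> Obj J. Fo j \<in> Obj C) \<and>
     (\<forall>u \<in> Arr J. Fa u \<in> hom C (Fo (dom J u)) (Fo (cod J u))) \<and>
     (\<forall>j \<in> Obj J. Fa (ident J j) = ident C (Fo j)) \<and>
     (\<forall>u \<in> Arr J. \<forall>v \<in> Arr J. dom J v = cod J u \<longrightarrow> Fa (v \<cdot>\<^bsub>J\<^esub> u) = Fa v \<cdot>\<^bsub>C\<^esub> Fa u)"

definition cone ::
    "('j, 'k) cat \<Rightarrow> ('o, 'a) cat \<Rightarrow> ('j \<Rightarrow> 'o) \<Rightarrow> ('k \<Rightarrow> 'a) \<Rightarrow> 'o \<Rightarrow> ('j \<Rightarrow> 'a) \<Rightarrow> bool" where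
  "cone J C Fo Fa L \<pi> \<longleftrightarrow>
     L \<in> Obj C \<and> (\<forall>j \<in> Obj J. \<pi> j \<in> hom C L (Fo j)) \<and>
     (\<forall>u \<in> Arr J. Fa u \<cdot>\<^bsub>C\<^esub> \<pi> (dom J u) = \<pi> (cod J u))"

definition limit_cone ::
    "('j, 'k) cat \<Rightarrow> ('o, 'a) cat \<Rightarrow> ('j \<Rightarrow> 'o) \<Rightarrow> ('k \<Rightarrow> 'a) \<Rightarrow> 'o \<Rightarrow> ('j \<Rightarrow> 'a) \<Rightarrow> bool" where
  "limit_cone J C Fo Fa L \<pi> \<longleftrightarrow>
     cone J C Fo Fa L \<pi> \<and>
     (\<forall>M \<mu>. cone J C Fo Fa M \<mu> \<longrightarrow>
        (\<exists>!h. h \<in> hom C M L \<and> (\<forall>j \<in> Obj J. \<pi> j \<cdot>\<^bsub>C\<^esub> h = \<mu> j)))"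

text \<open>Every finite category is isomorphic to one whose objects and arrows are natural numbers,
  so it suffices to let the shapes of finite diagrams range over the latter.\<close>

locale finitely_complete = category +
  assumes finite_limits:
    "\<And>(J :: (nat, nat) cat) Fo Fa.
       category J \<Longrightarrow> finite (Obj J) \<Longrightarrow> finite (Arr J) \<Longrightarrow> functor J C Fo Fa \<Longrightarrow>
       \<exists>L \<pi>. limit_cone J C Fo Fa L \<pi>"

definition product :: "('o, 'a) cat \<Rightarrow> 'o \<Rightarrow> 'o \<Rightarrow> 'o \<Rightarrow> 'a \<Rightarrow> 'a \<Rightarrow> bool" where
  "product C X Y P p q \<longleftrightarrow>
     X \<in> Obj C \<and> Y \<in> Obj C \<and> P \<in> Obj C \<and> p \<in> hom C P X \<and> q \<in> hom C P Y \<and>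
     (\<forall>T \<in> Obj C. \<forall>f \<in> hom C T X. \<forall>g \<in> hom C T Y.
        \<exists>!h. h \<in> hom C T P \<and> p \<cdot>\<^bsub>C\<^esub> h = f \<and> q \<cdot>\<^bsub>C\<^esub> h = g)"

definition monic :: "('o, 'a) cat \<Rightarrow> 'a \<Rightarrow> bool" where
  "monic C m \<longleftrightarrow> m \<in> Arr C \<and>
     (\<forall>T \<in> Obj C. \<forall>g \<in> hom C T (dom C m). \<forall>h \<in> hom C T (dom C m).
        m \<cdot>\<^bsub>C\<^esub> g = m \<cdot>\<^bsub>C\<^esub> h \<longrightarrow> g = h)"

definition iso :: "('o, 'a) cat \<Rightarrow> 'a \<Rightarrow> bool" where
  "iso C f \<longleftrightarrow> f \<in> Arr C \<and>
     (\<exists>g \<in> hom C (cod C f) (dom C f).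
        g \<cdot>\<^bsub>C\<^esub> f = ident C (dom C f) \<and> f \<cdot>\<^bsub>C\<^esub> g = ident C (cod C f))"

definition factors_through :: "('o, 'a) cat \<Rightarrow> 'a \<Rightarrow> 'a \<Rightarrow> bool" where
  "factors_through C f m \<longleftrightarrow> (\<exists>h \<in> hom C (dom C f) (dom C m). m \<cdot>\<^bsub>C\<^esub> h = f)"


section \<open>Internal relations\<close>

text \<open>A subobject of a product \<open>(P, p, q)\<close> of \<open>X\<close> and \<open>Y\<close> is represented by a monomorphism
  \<open>r\<close> from \<open>R\<close> to \<open>P\<close>; the legs of the relation are \<open>p \<cdot> r\<close> and \<open>q \<cdot> r\<close>. No products are
  chosen: statements about relations range over all product cones.\<close>

definition relation ::
    "('o, 'a) cat \<Rightarrow> 'o \<Rightarrow> 'o \<Rightarrow> 'o \<Rightarrow> 'a \<Rightarrow> 'a \<Rightarrow> 'o \<Rightarrow> 'a \<Rightarrow> bool" where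
  "relation C X Y P p q R r \<longleftrightarrow> product C X Y P p q \<and> monic C r \<and> r \<in> hom C R P"

text \<open>The relation induced on generalized elements of stage \<open>T\<close> by a pair of arrows
  \<open>f\<close>, \<open>g\<close> with common domain \<open>R\<close>.\<close>

definition elt_rel :: "('o, 'a) cat \<Rightarrow> 'o \<Rightarrow> 'a \<Rightarrow> 'a \<Rightarrow> 'o \<Rightarrow> ('a \<times> 'a) set" where
  "elt_rel C R f g T = {(f \<cdot>\<^bsub>C\<^esub> h, g \<cdot>\<^bsub>C\<^esub> h) | h. h \<in> hom C T R}"

definition difunctional :: "('o, 'a) cat \<Rightarrow> 'o \<Rightarrow> 'a \<Rightarrow> 'a \<Rightarrow> bool" where
  "difunctional C R f g \<longleftrightarrow>
     (\<forall>T \<in> Obj C. \<forall>x y u v.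
        (x, u) \<in> elt_rel C R f g T \<and> (y, u) \<in> elt_rel C R f g T \<and> (y, v) \<in> elt_rel C R f g T
        \<longrightarrow> (x, v) \<in> elt_rel C R f g T)"

definition reflexive_relation ::
    "('o, 'a) cat \<Rightarrow> 'o \<Rightarrow> 'o \<Rightarrow> 'a \<Rightarrow> 'a \<Rightarrow> 'o \<Rightarrow> 'a \<Rightarrow> bool" where
  "reflexive_relation C X P p q R r \<longleftrightarrow>
     relation C X X P p q R r \<and>
     (\<forall>T \<in> Obj C. refl_on (hom C T X) (elt_rel C R (p \<cdot>\<^bsub>C\<^esub> r) (q \<cdot>\<^bsub>C\<^esub> r) T))"

definition equivalence_relation ::
    "('o, 'a) cat \<Rightarrow> 'o \<Rightarrow> 'o \<Rightarrow> 'a \<Rightarrow> 'a \<Rightarrow> 'o \<Rightarrow> 'a \<Rightarrow> bool" where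
  "equivalence_relation C X P p q R r \<longleftrightarrow>
     relation C X X P p q R r \<and>
     (\<forall>T \<in> Obj C. equiv (hom C T X) (elt_rel C R (p \<cdot>\<^bsub>C\<^esub> r) (q \<cdot>\<^bsub>C\<^esub> r) T))"

locale malcev = finitely_complete +
  assumes reflexive_imp_equivalence:
    "reflexive_relation C X P p q R r \<Longrightarrow> equivalence_relation C X P p q R r"


section \<open>Pointed, unital and strongly unital categories\<close>

definition zero_object :: "('o, 'a) cat \<Rightarrow> 'o \<Rightarrow> bool" where
  "zero_object C Z \<longleftrightarrow> Z \<in> Obj C \<and>
     (\<forall>X \<in> Obj C. (\<exists>!f. f \<in> hom C Z X) \<and> (\<exists>!f. f \<in> hom C X Z))"

definition zero_arrow :: "('o, 'a) cat \<Rightarrow> 'o \<Rightarrow> 'o \<Rightarrow> 'a \<Rightarrow> bool" where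
  "zero_arrow C X Y f \<longleftrightarrow>
     (\<exists>Z. zero_object C Z \<and> (\<exists>a \<in> hom C X Z. \<exists>b \<in> hom C Z Y. f = b \<cdot>\<^bsub>C\<^esub> a))"

locale pointed = category +
  assumes has_zero_object: "\<exists>Z. zero_object C Z"

definition jointly_extremally_epic :: "('o, 'a) cat \<Rightarrow> 'a \<Rightarrow> 'a \<Rightarrow> 'o \<Rightarrow> bool" where
  "jointly_extremally_epic C k l P \<longleftrightarrow>
     (\<forall>m. monic C m \<and> cod C m = P \<and> factors_through C k m \<and> factors_through C l m \<longrightarrow> iso C m)"

text \<open>In the next locale, \<open>k\<close> is the arrow \<open>(1, 0)\<close> from \<open>X\<close> and \<open>l\<close> the arrow \<open>(0, 1)\<close> from \<open>Y\<close> into the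
  product \<open>P\<close>; they exist and are unique by the universal property.\<close>

locale unital = pointed + finitely_complete +
  assumes injections_jointly_extremally_epic:
    "product C X Y P p q \<Longrightarrow>
     k \<in> hom C X P \<Longrightarrow> p \<cdot> k = ident C X \<Longrightarrow> zero_arrow C X Y (q \<cdot> k) \<Longrightarrow>
     l \<in> hom C Y P \<Longrightarrow> zero_arrow C Y X (p \<cdot> l) \<Longrightarrow> q \<cdot> l = ident C Y \<Longrightarrow>
     jointly_extremally_epic C k l P"

definition right_punctual ::
    "('o, 'a) cat \<Rightarrow> 'o \<Rightarrow> 'o \<Rightarrow> 'a \<Rightarrow> 'a \<Rightarrow> 'a \<Rightarrow> bool" where
  "right_punctual C X P p q r \<longleftrightarrow>
     (\<exists>l \<in> hom C X P. zero_arrow C X X (p \<cdot>\<^bsub>C\<^esub> l) \<and> q \<cdot>\<^bsub>C\<^esub> l = ident C X \<and>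
        factors_through C l r)"

text \<open>The largest equivalence relation on \<open>X\<close> is the whole product \<open>P\<close>, i.e. the subobject of
  \<open>P\<close> represented by an isomorphism.\<close>

locale strongly_unital = pointed + finitely_complete +
  assumes right_punctual_reflexive_total:
    "reflexive_relation C X P p q R r \<Longrightarrow> right_punctual C X P p q r \<Longrightarrow> iso C r"


section \<open>The fibres of the fibration of points\<close>

text \<open>An object of the fibre over \<open>Y\<close> is a pair \<open>(f, s)\<close> with \<open>f \<cdot> s = 1\<close>; its underlying object
  is \<open>dom f\<close>. An arrow is a triple consisting of its source \<open>(f, s)\<close>, the underlying arrow \<open>x\<close>,
  and its target \<open>(f', s')\<close>, since \<open>x\<close> alone does not determine source and target.\<close>

definition Pt_obj :: "('o, 'a) cat \<Rightarrow> 'o \<Rightarrow> ('a \<times> 'a) set" where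
  "Pt_obj C Y = {(f, s). f \<in> Arr C \<and> cod C f = Y \<and> s \<in> hom C Y (dom C f) \<and>
                         f \<cdot>\<^bsub>C\<^esub> s = ident C Y}"

definition Pt_arr :: "('o, 'a) cat \<Rightarrow> 'o \<Rightarrow> (('a \<times> 'a) \<times> 'a \<times> ('a \<times> 'a)) set" where
  "Pt_arr C Y = {((f, s), x, (f', s')) | f s x f' s'.
      (f, s) \<in> Pt_obj C Y \<and> (f', s') \<in> Pt_obj C Y \<and> x \<in> hom C (dom C f) (dom C f') \<and>
      f' \<cdot>\<^bsub>C\<^esub> x = f \<and> x \<cdot>\<^bsub>C\<^esub> s = s'}"

definition Pt :: "('o, 'a) cat \<Rightarrow> 'o \<Rightarrow> ('a \<times> 'a, ('a \<times> 'a) \<times> 'a \<times> ('a \<times> 'a)) cat" where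
  "Pt C Y = \<lparr>
     Obj = Pt_obj C Y,
     Arr = Pt_arr C Y,
     dom = (\<lambda>(a, x, b). a),
     cod = (\<lambda>(a, x, b). b),
     ident = (\<lambda>(f, s). ((f, s), ident C (dom C f), (f, s))),
     comp = (\<lambda>(b', y, c) (a, x, b). (a, y \<cdot>\<^bsub>C\<^esub> x, c))\<rparr>"

end

theory Submission
  imports Defs
begin

text \<open>
  If \<open>S\<close> relates two elements \<open>(x, y)\<close>, \<open>(x', y')\<close> of a relation \<open>R\<close> when \<open>x R y'\<close>, then \<open>S\<close> is
  reflexive on \<open>R\<close>, and its transitivity is difunctionality of \<open>R\<close>. In a pointed category \<open>S\<close> is
  right punctual as soon as \<open>R\<close> contains both axes, so strongly unital implies unital; both
  properties follow from difunctionality, applied to \<open>x R 0\<close>, \<open>0 R 0\<close>, \<open>0 R y\<close> and to \<open>x R x\<close>,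
  \<open>0 R x\<close>, \<open>0 R y\<close>. Difunctionality passes to the fibres, because jointly monic pairs of a fibre
  are jointly monic in \<open>E\<close>. Conversely, for a relation \<open>R\<close> with legs \<open>f\<close>, \<open>g\<close>, difunctionality is
  unitality of the fibre over \<open>R\<close> at the kernel pairs of \<open>g\<close> and \<open>f\<close>.
\<close>

section \<open>Arrows and finite limits\<close>

text \<open>Three pairs \<open>x R u\<close>, \<open>y R u\<close>, \<open>y R v\<close> are three
  elements \<open>a\<close>, \<open>b\<close>, \<open>c\<close> of the object \<open>R\<close> with
  \<open>g a = g b\<close> and \<open>f b = f c\<close>. With the middle one as base point,
  \<open>(a, b)\<close> and \<open>(b, c)\<close> become elements of two kernel pairs over
  \<open>R\<close>, and gluing them along \<open>b\<close> is a product in the fibre over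
  \<open>R\<close>. The zero arrows of that fibre repeat the base point, so on each axis two
  neighbours coincide and the desired conclusion is trivial; unitality spreads it from the axes to
  all triples.

  Two obstacles shape the work on the fibres. Being unital or strongly unital includes having limits
  of all finite diagrams, and a limit of points over \<open>Y\<close> is a limit in \<open>C\<close>
  only once \<open>Y\<close> itself has been adjoined to the diagram. Moreover, a monic of a fibre
  cancels only arrows of points, whereas difunctionality in \<open>C\<close> is available for pairs
  that cancel all arrows of \<open>C\<close>.\<close>

definition pullback :: "('o, 'a) cat \<Rightarrow> 'a \<Rightarrow> 'a \<Rightarrow> 'o \<Rightarrow> 'a \<Rightarrow> 'a \<Rightarrow> bool" where
  "pullback C f g P p q \<longleftrightarrow>
     f \<in> Arr C \<and> g \<in> Arr C \<and> cod C f = cod C g \<and>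
     p \<in> hom C P (dom C f) \<and> q \<in> hom C P (dom C g) \<and> f \<cdot>\<^bsub>C\<^esub> p = g \<cdot>\<^bsub>C\<^esub> q \<and>
     (\<forall>T. \<forall>a \<in> hom C T (dom C f). \<forall>b \<in> hom C T (dom C g). f \<cdot>\<^bsub>C\<^esub> a = g \<cdot>\<^bsub>C\<^esub> b \<longrightarrow>
        (\<exists>!h. h \<in> hom C T P \<and> p \<cdot>\<^bsub>C\<^esub> h = a \<and> q \<cdot>\<^bsub>C\<^esub> h = b))"

text \<open>A relation given by its legs alone. Legs can be compared between a fibre and
  \<open>C\<close>, while the products in which the subobjects live differ;
  \<open>jointly_monic_relation\<close> recovers a subobject of a product.\<close>

definition jointly_monic :: "('o, 'a) cat \<Rightarrow> 'a \<Rightarrow> 'a \<Rightarrow> bool" where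
  "jointly_monic C f g \<longleftrightarrow>
     f \<in> Arr C \<and> g \<in> Arr C \<and> dom C f = dom C g \<and>
     (\<forall>T. \<forall>a \<in> hom C T (dom C f). \<forall>b \<in> hom C T (dom C f).
        f \<cdot>\<^bsub>C\<^esub> a = f \<cdot>\<^bsub>C\<^esub> b \<and> g \<cdot>\<^bsub>C\<^esub> a = g \<cdot>\<^bsub>C\<^esub> b \<longrightarrow> a = b)"

definition relations_difunctional :: "('o, 'a) cat \<Rightarrow> bool" where
  "relations_difunctional C \<longleftrightarrow>
     (\<forall>X Y P p q R r. relation C X Y P p q R r \<longrightarrow> difunctional C R (p \<cdot>\<^bsub>C\<^esub> r) (q \<cdot>\<^bsub>C\<^esub> r))"

lemma hom_arrD:
  assumes "f \<in> hom C X Y"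
  shows "f \<in> Arr C" "dom C f = X" "cod C f = Y"
  using assms by (auto simp: hom_def)

lemma (in category) hom_objD:
  assumes "f \<in> hom C X Y"
  shows "X \<in> Obj C" "Y \<in> Obj C"
  using assms dom_obj cod_obj by (auto simp: hom_def)

context category
begin

lemma comp_arr:
  assumes "f \<in> Arr C" "g \<in> Arr C" "dom C g = cod C f"
  shows "g \<cdot> f \<in> Arr C" "dom C (g \<cdot> f) = dom C f" "cod C (g \<cdot> f) = cod C g"
  using comp_hom[of f "dom C f" "cod C f" g "cod C g"] assms by (auto simp: hom_def)

lemma ident_arr:
  assumes "X \<in> Obj C"
  shows "ident C X \<in> Arr C" "dom C (ident C X) = X" "cod C (ident C X) = X"
  using ident_hom[OF assms] by (auto simp: hom_def)

lemma ident_comp: "f \<in> Arr C \<Longrightarrow> cod C f = Y \<Longrightarrow> ident C Y \<cdot> f = f"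
  using comp_ident_left by (auto simp: hom_def)

lemma comp_ident: "f \<in> Arr C \<Longrightarrow> dom C f = X \<Longrightarrow> f \<cdot> ident C X = f"
  using comp_ident_right by (auto simp: hom_def)

lemma assoc:
  "f \<in> Arr C \<Longrightarrow> g \<in> Arr C \<Longrightarrow> h \<in> Arr C \<Longrightarrow> dom C g = cod C f \<Longrightarrow> dom C h = cod C g
    \<Longrightarrow> (h \<cdot> g) \<cdot> f = h \<cdot> (g \<cdot> f)"
  using comp_assoc[of f "dom C f" "cod C f" g "cod C g" h "cod C h"] by (simp add: hom_def)

text \<open>With composites bracketed to the right by \<open>assoc\<close>, an equation
  \<open>g \<cdot> f = h\<close> no longer matches inside \<open>g \<cdot> (f \<cdot> z)\<close>;
  this form rewrites there.\<close>

lemma comp_reassoc: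
  "g \<cdot> f = h \<Longrightarrow> f \<in> Arr C \<Longrightarrow> g \<in> Arr C \<Longrightarrow> dom C g = cod C f
    \<Longrightarrow> z \<in> Arr C \<Longrightarrow> cod C z = dom C f \<Longrightarrow> g \<cdot> (f \<cdot> z) = h \<cdot> z"
  using assoc[of z f g] by simp

lemmas cat_simps = comp_arr ident_arr ident_comp comp_ident assoc dom_obj cod_obj

lemma pullbackD:
  assumes "pullback C f g P p q"
  shows "f \<in> Arr C" "g \<in> Arr C" "cod C f = cod C g" "p \<in> Arr C" "q \<in> Arr C"
    "dom C p = P" "dom C q = P" "cod C p = dom C f" "cod C q = dom C g" "P \<in> Obj C"
    "f \<cdot> p = g \<cdot> q"
  using assms dom_obj by (auto simp: pullback_def hom_def)

lemma pullback_jointly_monic: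
  assumes "pullback C f g P p q"
  shows "jointly_monic C p q"
  unfolding jointly_monic_def
proof (intro conjI allI ballI impI)
  note pb = pullbackD[OF assms]
  show "p \<in> Arr C" "q \<in> Arr C" "dom C p = dom C q"
    using pb by auto
  fix T a b assume ab: "a \<in> hom C T (dom C p)" "b \<in> hom C T (dom C p)"
    and eq: "p \<cdot> a = p \<cdot> b \<and> q \<cdot> a = q \<cdot> b"
  have "p \<cdot> a \<in> hom C T (dom C f)" "q \<cdot> a \<in> hom C T (dom C g)"
    using pb ab by (simp_all add: hom_def cat_simps)
  moreover have "f \<cdot> (p \<cdot> a) = g \<cdot> (q \<cdot> a)"
    using pb ab by (simp add: hom_def cat_simps comp_reassoc[OF pb(11)])
  ultimately have "\<exists>!h. h \<in> hom C T P \<and> p \<cdot> h = p \<cdot> a \<and> q \<cdot> h = q \<cdot> a"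
    using assms unfolding pullback_def by blast
  then show "a = b"
    using ab eq pb by auto
qed

lemma pullback_lift:
  assumes "pullback C f g P p q" "a \<in> Arr C" "b \<in> Arr C" "dom C a = dom C b"
    "cod C a = dom C f" "cod C b = dom C g" "f \<cdot> a = g \<cdot> b"
  obtains h where "h \<in> Arr C" "dom C h = dom C a" "cod C h = P" "p \<cdot> h = a" "q \<cdot> h = b"
proof -
  have "a \<in> hom C (dom C a) (dom C f)" "b \<in> hom C (dom C a) (dom C g)"
    using assms by (auto simp: hom_def)
  then have "\<exists>!h. h \<in> hom C (dom C a) P \<and> p \<cdot> h = a \<and> q \<cdot> h = b"
    using assms(1,7) unfolding pullback_def by blast
  then show ?thesis using that by (auto simp: hom_def)
qed

lemma jointly_monicD:
  assumes "jointly_monic C f g" "a \<in> Arr C" "b \<in> Arr C" "dom C a = dom C b"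
    "cod C a = dom C f" "cod C b = dom C f" "f \<cdot> a = f \<cdot> b" "g \<cdot> a = g \<cdot> b"
  shows "a = b"
  using assms unfolding jointly_monic_def hom_def by blast

lemma productD:
  assumes "product C X Y P p q"
  shows "X \<in> Obj C" "Y \<in> Obj C" "P \<in> Obj C" "p \<in> Arr C" "q \<in> Arr C"
    "dom C p = P" "dom C q = P" "cod C p = X" "cod C q = Y"
  using assms by (auto simp: product_def hom_def)

lemma product_jointly_monic:
  assumes "product C X Y P p q"
  shows "jointly_monic C p q"
  unfolding jointly_monic_def
proof (intro conjI allI ballI impI)
  note pr = productD[OF assms]
  show "p \<in> Arr C" "q \<in> Arr C" "dom C p = dom C q"
    using pr by auto
  fix T a b assume ab: "a \<in> hom C T (dom C p)" "b \<in> hom C T (dom C p)"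
    and eq: "p \<cdot> a = p \<cdot> b \<and> q \<cdot> a = q \<cdot> b"
  have "p \<cdot> a \<in> hom C T X" "q \<cdot> a \<in> hom C T Y" "T \<in> Obj C"
    using pr ab dom_obj by (auto simp add: hom_def cat_simps)
  then have "\<exists>!h. h \<in> hom C T P \<and> p \<cdot> h = p \<cdot> a \<and> q \<cdot> h = q \<cdot> a"
    using assms unfolding product_def by blast
  then show "a = b"
    using ab eq pr by auto
qed

lemma product_lift:
  assumes "product C X Y P p q" "a \<in> Arr C" "b \<in> Arr C" "dom C a = dom C b"
    "cod C a = X" "cod C b = Y"
  obtains h where "h \<in> Arr C" "dom C h = dom C a" "cod C h = P" "p \<cdot> h = a" "q \<cdot> h = b"
proof -
  have "a \<in> hom C (dom C a) X" "b \<in> hom C (dom C a) Y" "dom C a \<in> Obj C"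
    using assms dom_obj by (auto simp: hom_def)
  then have "\<exists>!h. h \<in> hom C (dom C a) P \<and> p \<cdot> h = a \<and> q \<cdot> h = b"
    using assms(1) unfolding product_def by blast
  then show ?thesis using that by (auto simp: hom_def)
qed

lemma monicD:
  assumes "monic C m" "a \<in> Arr C" "b \<in> Arr C" "dom C a = dom C b"
    "cod C a = dom C m" "cod C b = dom C m" "m \<cdot> a = m \<cdot> b"
  shows "a = b"
  using assms dom_obj[of b] unfolding monic_def hom_def by auto

lemma monic_split_epi_iso:
  assumes "monic C m" "h \<in> hom C (cod C m) (dom C m)" "m \<cdot> h = ident C (cod C m)"
  shows "iso C m"
proof -
  have m: "m \<in> Arr C" using assms(1) by (simp add: monic_def)
  note h = hom_arrD[OF assms(2)]
  have "h \<cdot> m = ident C (dom C m)"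
    by (rule monicD[OF assms(1)])
      (use m h in \<open>simp_all add: cat_simps comp_reassoc[OF assms(3)]\<close>)
  then show ?thesis using assms m unfolding iso_def by auto
qed

lemma pullback_monic:
  assumes "pullback C f g P p q" "monic C g"
  shows "monic C p"
  unfolding monic_def
proof (intro conjI ballI impI)
  note pb = pullbackD[OF assms(1)]
  show "p \<in> Arr C" by (fact pb)
  fix T a b assume ab: "a \<in> hom C T (dom C p)" "b \<in> hom C T (dom C p)" and eq: "p \<cdot> a = p \<cdot> b"
  note ab = hom_arrD[OF ab(1)] hom_arrD[OF ab(2)]
  have "q \<cdot> a = q \<cdot> b"
  proof (rule monicD[OF assms(2)])
    have "g \<cdot> (q \<cdot> a) = f \<cdot> (p \<cdot> a)" "g \<cdot> (q \<cdot> b) = f \<cdot> (p \<cdot> b)"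
      using pb ab by (simp_all add: cat_simps comp_reassoc[OF pb(11)])
    then show "g \<cdot> (q \<cdot> a) = g \<cdot> (q \<cdot> b)" using eq by simp
  qed (use pb ab in \<open>simp_all add: cat_simps\<close>)
  then show "a = b"
    using jointly_monicD[OF pullback_jointly_monic[OF assms(1)] ab(1,4)] ab pb eq by simp
qed

lemma relationD:
  assumes "relation C X Y P p q R r"
  shows "product C X Y P p q" "monic C r" "r \<in> Arr C" "dom C r = R" "cod C r = P" "R \<in> Obj C"
  using assms dom_obj by (auto simp: relation_def hom_def)

lemma relation_jointly_monic:
  assumes "relation C X Y P p q R r"
  shows "jointly_monic C (p \<cdot> r) (q \<cdot> r)"
  unfolding jointly_monic_def
proof (intro conjI allI ballI impI)
  note rl = relationD[OF assms]
  note pr = productD[OF rl(1)]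
  show "p \<cdot> r \<in> Arr C" "q \<cdot> r \<in> Arr C" "dom C (p \<cdot> r) = dom C (q \<cdot> r)"
    using rl pr by (simp_all add: cat_simps)
  fix T a b assume ab: "a \<in> hom C T (dom C (p \<cdot> r))" "b \<in> hom C T (dom C (p \<cdot> r))"
    and eq: "(p \<cdot> r) \<cdot> a = (p \<cdot> r) \<cdot> b \<and> (q \<cdot> r) \<cdot> a = (q \<cdot> r) \<cdot> b"
  note ab = hom_arrD[OF ab(1)] hom_arrD[OF ab(2)]
  have "r \<cdot> a = r \<cdot> b"
    by (rule jointly_monicD[OF product_jointly_monic[OF rl(1)]])
      (use pr rl ab eq in \<open>simp_all add: cat_simps\<close>)
  then show "a = b"
    by (rule monicD[OF rl(2) ab(1,4), rotated -1])
      (use pr rl ab in \<open>simp_all add: cat_simps\<close>)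
qed

lemma elt_relI:
  "h \<in> Arr C \<Longrightarrow> dom C h = T \<Longrightarrow> cod C h = R \<Longrightarrow> f \<cdot> h = a \<Longrightarrow> g \<cdot> h = b
    \<Longrightarrow> (a, b) \<in> elt_rel C R f g T"
  unfolding elt_rel_def hom_def by blast

lemma elt_relE:
  assumes "(a, b) \<in> elt_rel C R f g T"
  obtains h where "h \<in> Arr C" "dom C h = T" "cod C h = R" "f \<cdot> h = a" "g \<cdot> h = b"
  using assms unfolding elt_rel_def hom_def by blast

end

section \<open>Binary products and pullbacks from finite limits\<close>

definition product_shape :: "(nat, nat) cat" where
  "product_shape = \<lparr>Obj = {0, 1}, Arr = {0, 1}, dom = id, cod = id, ident = id,
     comp = (\<lambda>v u. v)\<rparr>"

text \<open>The arrows \<open>3\<close> and \<open>4\<close> form the cospan from \<open>0\<close> and \<open>1\<close> to \<open>2\<close>; the others are identities.\<close>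

definition pullback_shape :: "(nat, nat) cat" where
  "pullback_shape = \<lparr>Obj = {0, 1, 2}, Arr = {0, 1, 2, 3, 4},
     dom = (\<lambda>u. if u = 3 then 0 else if u = 4 then 1 else u), cod = (\<lambda>u. min u 2), ident = id,
     comp = (\<lambda>v u. if u < 3 then v else u)\<rparr>"

lemma category_product_shape: "category product_shape"
  by (unfold_locales; auto simp: product_shape_def hom_def)

lemma category_pullback_shape: "category pullback_shape"
  by (unfold_locales; auto simp: pullback_shape_def hom_def split: if_splits)

lemma finite_product_shape: "finite (Obj product_shape)" "finite (Arr product_shape)"
  by (simp_all add: product_shape_def)

lemma finite_pullback_shape: "finite (Obj pullback_shape)" "finite (Arr pullback_shape)"
  by (simp_all add: pullback_shape_def)

context finitely_complete
begin

lemma product_exists: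
  assumes X: "X \<in> Obj C" and Y: "Y \<in> Obj C"
  obtains P p q where "product C X Y P p q"
proof -
  let ?Fo = "\<lambda>j::nat. if j = 0 then X else Y"
  let ?Fa = "\<lambda>j::nat. ident C (?Fo j)"
  have "functor product_shape C ?Fo ?Fa"
    using X Y ident_hom by (auto simp: functor_def product_shape_def cat_simps)
  then obtain L \<pi> where L: "limit_cone product_shape C ?Fo ?Fa L \<pi>"
    using finite_limits[OF category_product_shape finite_product_shape] by blast
  have cone: "cone product_shape C ?Fo ?Fa M \<mu> \<longleftrightarrow> \<mu> 0 \<in> hom C M X \<and> \<mu> 1 \<in> hom C M Y" for M \<mu>
    using hom_objD(1)[of "\<mu> 0" M X] by (auto simp: cone_def product_shape_def hom_def ident_comp)
  have "product C X Y L (\<pi> 0) (\<pi> 1)"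
    unfolding product_def
  proof (intro conjI ballI)
    show "\<pi> 0 \<in> hom C L X" "\<pi> 1 \<in> hom C L Y" "L \<in> Obj C"
      using L cone unfolding limit_cone_def by (auto simp: cone_def)
    fix T f g assume T: "T \<in> Obj C" and fg: "f \<in> hom C T X" "g \<in> hom C T Y"
    have "cone product_shape C ?Fo ?Fa T (\<lambda>j. if j = 0 then f else g)"
      using fg cone by simp
    then have "\<exists>!h. h \<in> hom C T L \<and>
        (\<forall>j \<in> Obj product_shape. \<pi> j \<cdot> h = (if j = 0 then f else g))"
      using L unfolding limit_cone_def by blast
    then show "\<exists>!h. h \<in> hom C T L \<and> \<pi> 0 \<cdot> h = f \<and> \<pi> 1 \<cdot> h = g"
      by (simp add: product_shape_def)
  qed (use X Y in auto)
  then show ?thesis using that by blast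
qed

lemma pullback_exists:
  assumes f: "f \<in> Arr C" and g: "g \<in> Arr C" and fg: "cod C f = cod C g"
  obtains P p q where "pullback C f g P p q"
proof -
  let ?Fo = "\<lambda>j::nat. if j = 0 then dom C f else if j = 1 then dom C g else cod C g"
  let ?Fa = "\<lambda>u::nat. if u = 3 then f else if u = 4 then g else ident C (?Fo u)"
  have "functor pullback_shape C ?Fo ?Fa"
    using f g fg dom_obj cod_obj ident_hom
    by (auto simp: functor_def pullback_shape_def hom_def cat_simps)
  then obtain L \<pi> where L: "limit_cone pullback_shape C ?Fo ?Fa L \<pi>"
    using finite_limits[OF category_pullback_shape finite_pullback_shape] by blast
  have cone: "cone pullback_shape C ?Fo ?Fa M \<mu> \<longleftrightarrow>
      \<mu> 0 \<in> hom C M (dom C f) \<and> \<mu> 1 \<in> hom C M (dom C g) \<and> f \<cdot> \<mu> 0 = \<mu> 2 \<and> g \<cdot> \<mu> 1 = \<mu> 2" for M \<mu>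
  proof
    assume \<mu>: "\<mu> 0 \<in> hom C M (dom C f) \<and> \<mu> 1 \<in> hom C M (dom C g) \<and> f \<cdot> \<mu> 0 = \<mu> 2 \<and> g \<cdot> \<mu> 1 = \<mu> 2"
    then have "\<mu> 2 \<in> hom C M (cod C g)" "M \<in> Obj C"
      using comp_hom[of "\<mu> 1" M "dom C g" g "cod C g"] hom_objD(1)[of "\<mu> 0"] g
      by (simp_all add: hom_def)
    with \<mu> show "cone pullback_shape C ?Fo ?Fa M \<mu>"
      by (simp add: cone_def pullback_shape_def hom_def ident_comp)
  qed (simp add: cone_def pullback_shape_def)
  have \<pi>: "\<pi> 0 \<in> hom C L (dom C f)" "\<pi> 1 \<in> hom C L (dom C g)" "f \<cdot> \<pi> 0 = \<pi> 2" "g \<cdot> \<pi> 1 = \<pi> 2"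
    using L cone[of L \<pi>] by (simp_all add: limit_cone_def)
  have "pullback C f g L (\<pi> 0) (\<pi> 1)"
    unfolding pullback_def
  proof (intro conjI allI ballI impI)
    fix T a b assume ab: "a \<in> hom C T (dom C f)" "b \<in> hom C T (dom C g)" and eq: "f \<cdot> a = g \<cdot> b"
    let ?\<mu> = "\<lambda>j::nat. if j = 0 then a else if j = 1 then b else f \<cdot> a"
    have "cone pullback_shape C ?Fo ?Fa T ?\<mu>"
      using ab eq cone by simp
    then have ex: "\<exists>!h. h \<in> hom C T L \<and> (\<forall>j \<in> Obj pullback_shape. \<pi> j \<cdot> h = ?\<mu> j)"
      using L unfolding limit_cone_def by blast
    \<comment> \<open>The leg at the corner \<open>2\<close> is \<open>f\<close> after the leg at
      \<open>0\<close>, so the equation at \<open>2\<close> follows from the one at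
      \<open>0\<close>.\<close>
    have "(h \<in> hom C T L \<and> (\<forall>j \<in> Obj pullback_shape. \<pi> j \<cdot> h = ?\<mu> j)) \<longleftrightarrow>
        (h \<in> hom C T L \<and> \<pi> 0 \<cdot> h = a \<and> \<pi> 1 \<cdot> h = b)" for h
    proof -
      have "\<pi> 2 \<cdot> h = f \<cdot> (\<pi> 0 \<cdot> h)" if "h \<in> hom C T L"
        using comp_assoc[OF that \<pi>(1), of f] f \<pi>(3) by (simp add: hom_def)
      then show ?thesis by (auto simp: pullback_shape_def)
    qed
    then show "\<exists>!h. h \<in> hom C T L \<and> \<pi> 0 \<cdot> h = a \<and> \<pi> 1 \<cdot> h = b"
      using ex by simp
  qed (use f g fg \<pi> in simp_all)
  then show ?thesis using that by blast
qed

lemma jointly_monic_relation: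
  assumes "jointly_monic C f g"
  obtains P p q r where "relation C (cod C f) (cod C g) P p q (dom C f) r" "p \<cdot> r = f" "q \<cdot> r = g"
proof -
  have fg: "f \<in> Arr C" "g \<in> Arr C" "dom C f = dom C g"
    using assms by (auto simp: jointly_monic_def)
  obtain P p q where P: "product C (cod C f) (cod C g) P p q"
    using product_exists cod_obj fg by metis
  note pr = productD[OF P]
  obtain r where r: "r \<in> Arr C" "dom C r = dom C f" "cod C r = P" "p \<cdot> r = f" "q \<cdot> r = g"
    using product_lift[OF P fg(1,2,3)] by auto
  have "monic C r"
    unfolding monic_def
  proof (intro conjI ballI impI)
    show "r \<in> Arr C" by (fact r)
    fix T a b assume ab: "a \<in> hom C T (dom C r)" "b \<in> hom C T (dom C r)" and eq: "r \<cdot> a = r \<cdot> b"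
    note ab = hom_arrD[OF ab(1)] hom_arrD[OF ab(2)]
    have "f \<cdot> a = f \<cdot> b" "g \<cdot> a = g \<cdot> b"
      using r(1-3) ab eq pr by (simp_all add: assoc flip: r(4,5))
    then show "a = b"
      using jointly_monicD[OF assms ab(1,4)] ab r by simp
  qed
  then have "relation C (cod C f) (cod C g) P p q (dom C f) r"
    using P r by (simp add: relation_def hom_def)
  then show ?thesis using that r by blast
qed

lemma difunctional_jointly_monic:
  assumes "relations_difunctional C" "jointly_monic C f g"
  shows "difunctional C (dom C f) f g"
proof -
  obtain P p q r where "relation C (cod C f) (cod C g) P p q (dom C f) r" "p \<cdot> r = f" "q \<cdot> r = g"
    using jointly_monic_relation[OF assms(2)] .
  then show ?thesis
    using assms(1) unfolding relations_difunctional_def by blast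
qed

end

section \<open>Difunctional relations and unital categories\<close>

context category
begin

lemma zero_arrow_hom: "zero_arrow C X Y f \<Longrightarrow> f \<in> hom C X Y"
  unfolding zero_arrow_def using comp_hom by blast

lemma zero_objectD:
  assumes "zero_object C Z"
  shows "X \<in> Obj C \<Longrightarrow> \<exists>f. f \<in> hom C Z X"
    and "f \<in> hom C Z X \<Longrightarrow> g \<in> hom C Z X \<Longrightarrow> f = g"
    and "f \<in> hom C X Z \<Longrightarrow> g \<in> hom C X Z \<Longrightarrow> f = g"
  using assms hom_objD[of f] unfolding zero_object_def by metis+

text \<open>The two arrows may factor through different zero objects; the arrow \<open>i\<close>
  between these objects carries one factorisation to the other.\<close>

lemma zero_arrow_unique:
  assumes "zero_arrow C X Y f" "zero_arrow C X Y g"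
  shows "f = g"
proof -
  obtain Z a b where Z: "zero_object C Z" "a \<in> hom C X Z" "b \<in> hom C Z Y" "f = b \<cdot> a"
    using assms(1) unfolding zero_arrow_def by blast
  obtain Z' a' b' where Z': "zero_object C Z'" "a' \<in> hom C X Z'" "b' \<in> hom C Z' Y" "g = b' \<cdot> a'"
    using assms(2) unfolding zero_arrow_def by blast
  obtain i where i: "i \<in> hom C Z Z'"
    using zero_objectD(1)[OF Z(1) hom_objD(1)[OF Z'(3)]] by blast
  have "i \<cdot> a = a'"
    by (rule zero_objectD(3)[OF Z'(1) comp_hom[OF Z(2) i] Z'(2)])
  moreover have "b' \<cdot> i = b"
    by (rule zero_objectD(2)[OF Z(1) comp_hom[OF i Z'(3)] Z(3)])
  ultimately show ?thesis
    using comp_assoc[OF Z(2) i Z'(3)] Z(4) Z'(4) by simp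
qed

lemma zero_arrow_comp_right:
  assumes "zero_arrow C X Y f" "h \<in> hom C T X"
  shows "zero_arrow C T Y (f \<cdot> h)"
proof -
  obtain Z a b where Z: "zero_object C Z" "a \<in> hom C X Z" "b \<in> hom C Z Y" "f = b \<cdot> a"
    using assms(1) unfolding zero_arrow_def by blast
  then have "f \<cdot> h = b \<cdot> (a \<cdot> h)" "a \<cdot> h \<in> hom C T Z"
    using comp_assoc[OF assms(2) Z(2,3)] comp_hom[OF assms(2) Z(2)] by simp_all
  then show ?thesis
    using Z unfolding zero_arrow_def by blast
qed

lemma zero_arrow_comp_left:
  assumes "zero_arrow C X Y f" "h \<in> hom C Y T"
  shows "zero_arrow C X T (h \<cdot> f)"
proof -
  obtain Z a b where Z: "zero_object C Z" "a \<in> hom C X Z" "b \<in> hom C Z Y" "f = b \<cdot> a"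
    using assms(1) unfolding zero_arrow_def by blast
  then have "h \<cdot> f = (h \<cdot> b) \<cdot> a" "h \<cdot> b \<in> hom C Z T"
    using comp_assoc[OF Z(2,3) assms(2)] comp_hom[OF Z(3) assms(2)] by simp_all
  then show ?thesis
    using Z unfolding zero_arrow_def by blast
qed

lemma factors_throughE:
  assumes "factors_through C k m"
  obtains a where "a \<in> Arr C" "dom C a = dom C k" "cod C a = dom C m" "m \<cdot> a = k"
  using assms unfolding factors_through_def hom_def by blast

lemma product_homD:
  assumes "product C X Y P p q"
  shows "p \<in> hom C P X" "q \<in> hom C P Y"
  using assms unfolding product_def by auto

lemma difunctionalD:
  assumes "difunctional C R f g" "T \<in> Obj C" "(x, u) \<in> elt_rel C R f g T"
    "(y, u) \<in> elt_rel C R f g T" "(y, v) \<in> elt_rel C R f g T"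
  shows "(x, v) \<in> elt_rel C R f g T"
  using assms unfolding difunctional_def by blast

lemma relations_difunctionalD:
  "relations_difunctional C \<Longrightarrow> relation C X Y P p q R r \<Longrightarrow> difunctional C R (p \<cdot> r) (q \<cdot> r)"
  unfolding relations_difunctional_def by blast

lemma reflexive_relationD:
  assumes "reflexive_relation C X P p q R r"
  shows "relation C X X P p q R r"
    and "T \<in> Obj C \<Longrightarrow> x \<in> hom C T X \<Longrightarrow> (x, x) \<in> elt_rel C R (p \<cdot> r) (q \<cdot> r) T"
  using assms unfolding reflexive_relation_def by (auto dest: refl_onD)

lemma elt_rel_subset_hom:
  assumes "relation C X Y P p q R r"
  shows "elt_rel C R (p \<cdot> r) (q \<cdot> r) T \<subseteq> hom C T X \<times> hom C T Y"
  using relationD[OF assms] productD[OF relationD(1)[OF assms]]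
  by (auto simp: elt_rel_def hom_def cat_simps)

text \<open>The pair of projections is the generic element of the product. A witness that it belongs
  to the relation is a section of \<open>r\<close>, and a monic with a section is
  invertible.\<close>

lemma relation_iso_if_total:
  assumes "relation C X Y P p q R r" "(p, q) \<in> elt_rel C R (p \<cdot> r) (q \<cdot> r) P"
  shows "iso C r"
proof -
  note rl = relationD[OF assms(1)]
  note pr = productD[OF rl(1)]
  obtain h where h: "h \<in> Arr C" "dom C h = P" "cod C h = R" "(p \<cdot> r) \<cdot> h = p" "(q \<cdot> r) \<cdot> h = q"
    using elt_relE[OF assms(2)] .
  have "r \<cdot> h = ident C P"
    by (rule jointly_monicD[OF product_jointly_monic[OF rl(1)]])
      (use rl pr h in \<open>simp_all add: cat_simps\<close>)
  then show ?thesis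
    using monic_split_epi_iso[OF rl(2), of h] rl h by (simp add: hom_def)
qed

text \<open>Reflexivity fills the missing corners: symmetry of \<open>x R y\<close> comes from
  \<open>y R y\<close>, \<open>x R y\<close>, \<open>x R x\<close>, and transitivity of
  \<open>x R y\<close>, \<open>y R z\<close> from \<open>x R y\<close>, \<open>y R y\<close>,
  \<open>y R z\<close>.\<close>

lemma difunctional_imp_reflexive_equivalence:
  assumes "relations_difunctional C" "reflexive_relation C X P p q R r"
  shows "equivalence_relation C X P p q R r"
  unfolding equivalence_relation_def
proof (intro conjI ballI)
  note rel = reflexive_relationD[OF assms(2)]
  show "relation C X X P p q R r" by (fact rel(1))
  fix T assume T: "T \<in> Obj C"
  let ?E = "elt_rel C R (p \<cdot> r) (q \<cdot> r) T"
  note dif = difunctionalD[OF relations_difunctionalD[OF assms(1) rel(1)] T]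
  have sub: "?E \<subseteq> hom C T X \<times> hom C T X"
    by (rule elt_rel_subset_hom[OF rel(1)])
  have "sym ?E"
    using dif rel(2)[OF T] sub by (intro symI) blast
  moreover have "trans ?E"
    using dif rel(2)[OF T] sub by (intro transI) blast
  moreover have "refl_on (hom C T X) ?E"
    using assms(2) T unfolding reflexive_relation_def by blast
  ultimately show "equiv (hom C T X) ?E"
    using sub by (simp add: equiv_def)
qed

end

section \<open>The auxiliary reflexive relation and the consequences of difunctionality\<close>

context finitely_complete
begin

text \<open>On the elements of a relation between \<open>X\<close> and \<open>Y\<close>, relate \<open>(x, y)\<close> to \<open>(x', y')\<close> if \<open>x\<close> is
  related to \<open>y'\<close>. This relation is reflexive, and difunctionality of the given relation is
  an instance of its transitivity.\<close>

lemma shear_relation: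
  assumes rel: "relation C X Y P p q R r"
  obtains Q p1 p2 S s where "reflexive_relation C R Q p1 p2 S s"
    "\<And>T a b. (a, b) \<in> elt_rel C S (p1 \<cdot> s) (p2 \<cdot> s) T \<longleftrightarrow>
       a \<in> hom C T R \<and> b \<in> hom C T R \<and> (p \<cdot> r \<cdot> a, q \<cdot> r \<cdot> b) \<in> elt_rel C R (p \<cdot> r) (q \<cdot> r) T"
proof -
  note rl = relationD[OF rel]
  note pr = productD[OF rl(1)]
  obtain Q p1 p2 where Q: "product C R R Q p1 p2"
    using product_exists rl(6) by metis
  note qr = productD[OF Q]
  \<comment> \<open>\<open>w\<close> sends a pair of elements of \<open>R\<close> to the first leg
    of the one and the second leg of the other; \<open>S\<close> is the inverse image of
    \<open>r\<close> along it.\<close>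
  obtain w where w: "w \<in> Arr C" "dom C w = Q" "cod C w = P" "p \<cdot> w = p \<cdot> r \<cdot> p1" "q \<cdot> w = q \<cdot> r \<cdot> p2"
    using product_lift[OF rl(1), of "p \<cdot> r \<cdot> p1" "q \<cdot> r \<cdot> p2"] rl pr qr by (auto simp: comp_arr)
  obtain S s n where S: "pullback C w r S s n"
    using pullback_exists[OF w(1) rl(3)] w rl by auto
  note sr = pullbackD[OF S]
  have relS: "relation C R R Q p1 p2 S s"
    using Q pullback_monic[OF S rl(2)] sr w by (simp add: relation_def hom_def)
  have elt: "(a, b) \<in> elt_rel C S (p1 \<cdot> s) (p2 \<cdot> s) T \<longleftrightarrow>
      a \<in> hom C T R \<and> b \<in> hom C T R \<and> (p \<cdot> r \<cdot> a, q \<cdot> r \<cdot> b) \<in> elt_rel C R (p \<cdot> r) (q \<cdot> r) T"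
    (is "?L \<longleftrightarrow> ?A \<and> ?B \<and> ?R") for T a b
  proof
    assume ?L
    then obtain h where h: "h \<in> Arr C" "dom C h = T" "cod C h = S"
      "(p1 \<cdot> s) \<cdot> h = a" "(p2 \<cdot> s) \<cdot> h = b"
      by (rule elt_relE)
    have ab: "?A \<and> ?B"
      using h(1-3) sr qr w by (simp add: hom_def cat_simps flip: h(4,5))
    have "p \<cdot> (w \<cdot> (s \<cdot> h)) = p \<cdot> r \<cdot> a" "q \<cdot> (w \<cdot> (s \<cdot> h)) = q \<cdot> r \<cdot> b"
      using h(1-3) sr(1-10) rl qr pr w(1-3)
      by (simp_all add: cat_simps comp_reassoc[OF w(4)] comp_reassoc[OF w(5)] flip: h(4,5))
    moreover have "w \<cdot> (s \<cdot> h) = r \<cdot> (n \<cdot> h)"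
      using h(1-3) sr w by (simp add: cat_simps comp_reassoc[OF sr(11)])
    ultimately have "?R"
      by (intro elt_relI[of "n \<cdot> h"]) (use h(1-3) sr rl pr in \<open>simp_all add: cat_simps\<close>)
    with ab show "?A \<and> ?B \<and> ?R" by blast
  next
    assume *: "?A \<and> ?B \<and> ?R"
    then have a: "a \<in> Arr C" "dom C a = T" "cod C a = R"
      and b: "b \<in> Arr C" "dom C b = T" "cod C b = R"
      by (auto simp: hom_def)
    obtain k where k: "k \<in> Arr C" "dom C k = T" "cod C k = R"
      "p \<cdot> r \<cdot> k = p \<cdot> r \<cdot> a" "q \<cdot> r \<cdot> k = q \<cdot> r \<cdot> b"
      using * by (auto elim: elt_relE)
    obtain c where c: "c \<in> Arr C" "dom C c = T" "cod C c = Q" "p1 \<cdot> c = a" "p2 \<cdot> c = b"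
      using product_lift[OF Q a(1) b(1)] a b by auto
    have "p \<cdot> (w \<cdot> c) = p \<cdot> (r \<cdot> k)" "q \<cdot> (w \<cdot> c) = q \<cdot> (r \<cdot> k)"
      using k c w rl pr qr a b
      by (simp_all add: cat_simps comp_reassoc[OF w(4)] comp_reassoc[OF w(5)])
    then have wc: "w \<cdot> c = r \<cdot> k"
      by (rule jointly_monicD[OF product_jointly_monic[OF rl(1)], rotated -2])
        (use k c w rl pr in \<open>simp_all add: cat_simps\<close>)
    obtain h where "h \<in> Arr C" "dom C h = T" "cod C h = S" "s \<cdot> h = c"
      using pullback_lift[OF S c(1) k(1) _ _ _ wc] c(2,3) k(2,3) w(2) rl(4) by metis
    then show ?L
      using c qr sr w by (intro elt_relI[of h]) (simp_all add: cat_simps)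
  qed
  have "refl_on (hom C T R) (elt_rel C S (p1 \<cdot> s) (p2 \<cdot> s) T)" if "T \<in> Obj C" for T
  proof -
    \<comment> \<open>The element \<open>a\<close> of \<open>R\<close> is itself the witness that
      its two legs are related.\<close>
    have "(a, a) \<in> elt_rel C S (p1 \<cdot> s) (p2 \<cdot> s) T" if a: "a \<in> hom C T R" for a
      using elt a elt_relI[of a T R "p \<cdot> r" _ "q \<cdot> r"] by (simp add: hom_def)
    then show ?thesis by (auto simp: refl_on_def)
  qed
  then show ?thesis
    using that elt relS unfolding reflexive_relation_def by blast
qed

lemma difunctional_imp_unital:
  assumes "relations_difunctional C" "pointed C"
  shows "unital C"
proof (intro unital.intro unital_axioms.intro finitely_complete_axioms assms(2))
  fix X Y P p q k l
  assume P: "product C X Y P p q"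
    and k: "k \<in> hom C X P" "p \<cdot> k = ident C X" "zero_arrow C X Y (q \<cdot> k)"
    and l: "l \<in> hom C Y P" "zero_arrow C Y X (p \<cdot> l)" "q \<cdot> l = ident C Y"
  note pr = productD[OF P]
  note k1 = hom_arrD[OF k(1)] note l1 = hom_arrD[OF l(1)]
  show "jointly_extremally_epic C k l P"
    unfolding jointly_extremally_epic_def
  proof (intro allI impI)
    fix m assume *: "monic C m \<and> cod C m = P \<and> factors_through C k m \<and> factors_through C l m"
    let ?R = "dom C m"
    have m: "m \<in> Arr C" "cod C m = P" using * by (auto simp: monic_def)
    obtain a where a: "a \<in> Arr C" "dom C a = X" "cod C a = ?R" "m \<cdot> a = k"
      using * k1(2) factors_throughE by metis
    obtain b where b: "b \<in> Arr C" "dom C b = Y" "cod C b = ?R" "m \<cdot> b = l"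
      using * l1(2) factors_throughE by metis
    have rel: "relation C X Y P p q ?R m"
      using P * m by (simp add: relation_def hom_def)
    let ?E = "elt_rel C ?R (p \<cdot> m) (q \<cdot> m) P"
    \<comment> \<open>\<open>?x\<close> and \<open>?y\<close> are the zeros of \<open>X\<close> and
      \<open>Y\<close> at stage \<open>P\<close>, where \<open>(p, q)\<close> is the generic
      element. Written as composites with \<open>l\<close> and \<open>k\<close>, they are legs of
      arrows that factor through \<open>b\<close> and \<open>a\<close>.\<close>
    let ?x = "(p \<cdot> l) \<cdot> q" and ?y = "(q \<cdot> k) \<cdot> p"
    have x: "zero_arrow C P X ?x" and y: "zero_arrow C P Y ?y"
      using zero_arrow_comp_right[OF l(2) product_homD(2)[OF P]]
        zero_arrow_comp_right[OF k(3) product_homD(1)[OF P]] .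
    have x1: "?x \<in> hom C P X" using zero_arrow_hom[OF x] .
    have "zero_arrow C P Y ((q \<cdot> k) \<cdot> ?x)"
      by (rule zero_arrow_comp_right[OF k(3) x1])
    then have yx: "(q \<cdot> k) \<cdot> ?x = ?y"
      using zero_arrow_unique y by blast
    have "(p, ?y) \<in> ?E"
      by (rule elt_relI[of "a \<cdot> p"])
        (use a m pr k k1 in \<open>simp_all add: cat_simps comp_reassoc[OF a(4)] comp_reassoc[OF k(2)]\<close>)
    \<comment> \<open>The pair of zeros lies on the axis \<open>a\<close>, taken at the zero element
      \<open>?x\<close>; its second leg is again a zero arrow, hence \<open>?y\<close>.\<close>
    moreover have "(?x, ?y) \<in> ?E"
      unfolding yx[symmetric]
      by (rule elt_relI[of "a \<cdot> ?x"])
        (use a m pr k k1 l1 in \<open>simp_all add: cat_simps comp_reassoc[OF a(4)] comp_reassoc[OF k(2)]\<close>)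
    moreover have "(?x, q) \<in> ?E"
      by (rule elt_relI[of "b \<cdot> q"])
        (use b m pr l l1 in \<open>simp_all add: cat_simps comp_reassoc[OF b(4)] comp_reassoc[OF l(3)]\<close>)
    ultimately have "(p, q) \<in> ?E"
      using difunctionalD[OF relations_difunctionalD[OF assms(1) rel] pr(3)] by blast
    then show "iso C m"
      by (rule relation_iso_if_total[OF rel])
  qed
qed

lemma difunctional_imp_strongly_unital:
  assumes "relations_difunctional C" "pointed C"
  shows "strongly_unital C"
proof (intro strongly_unital.intro strongly_unital_axioms.intro finitely_complete_axioms assms(2))
  fix X P p q R r
  assume refl: "reflexive_relation C X P p q R r" and rp: "right_punctual C X P p q r"
  note rel = reflexive_relationD[OF refl]
  note rl = relationD[OF rel(1)]
  note pr = productD[OF rl(1)]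
  obtain l where l: "l \<in> hom C X P" "zero_arrow C X X (p \<cdot> l)" "q \<cdot> l = ident C X"
    "factors_through C l r"
    using rp unfolding right_punctual_def by blast
  note l1 = hom_arrD[OF l(1)]
  obtain b where b: "b \<in> Arr C" "dom C b = X" "cod C b = R" "r \<cdot> b = l"
    using l(4) l1(2) rl(4) factors_throughE by metis
  let ?E = "elt_rel C R (p \<cdot> r) (q \<cdot> r) P"
  let ?x = "(p \<cdot> l) \<cdot> p"
  \<comment> \<open>The axis \<open>b\<close> taken at \<open>p\<close> and at \<open>q\<close>
    gives \<open>0 R p\<close> and \<open>0 R q\<close>. The two zeros must be the same arrow for
    difunctionality to apply.\<close>
  have "(p \<cdot> l) \<cdot> q = ?x"
    by (rule zero_arrow_unique) (rule zero_arrow_comp_right[OF l(2)] product_homD[OF rl(1)])+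
  then have xq: "p \<cdot> (l \<cdot> q) = ?x"
    using l1 pr by (simp add: cat_simps)
  have "(p, p) \<in> ?E"
    by (rule rel(2)[OF pr(3) product_homD(1)[OF rl(1)]])
  moreover have "(?x, p) \<in> ?E"
    by (rule elt_relI[of "b \<cdot> p"])
      (use b rl pr l l1 in \<open>simp_all add: cat_simps comp_reassoc[OF b(4)] comp_reassoc[OF l(3)]\<close>)
  moreover have "(?x, q) \<in> ?E"
    unfolding xq[symmetric]
    by (rule elt_relI[of "b \<cdot> q"])
      (use b rl pr l l1 in \<open>simp_all add: cat_simps comp_reassoc[OF b(4)] comp_reassoc[OF l(3)]\<close>)
  ultimately have "(p, q) \<in> ?E"
    using difunctionalD[OF relations_difunctionalD[OF assms(1) rel(1)] pr(3)] by blast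
  then show "iso C r"
    by (rule relation_iso_if_total[OF rel(1)])
qed

end

section \<open>From the Mal'tsev and strongly unital conditions\<close>

lemma (in malcev) malcev_imp_difunctional: "relations_difunctional C"
  unfolding relations_difunctional_def
proof (intro allI impI)
  fix X Y P p q R r assume rel: "relation C X Y P p q R r"
  obtain Q p1 p2 S s where S: "reflexive_relation C R Q p1 p2 S s"
    and elt: "\<And>T a b. (a, b) \<in> elt_rel C S (p1 \<cdot> s) (p2 \<cdot> s) T \<longleftrightarrow>
       a \<in> hom C T R \<and> b \<in> hom C T R \<and> (p \<cdot> r \<cdot> a, q \<cdot> r \<cdot> b) \<in> elt_rel C R (p \<cdot> r) (q \<cdot> r) T"
    using shear_relation[OF rel] by blast
  show "difunctional C R (p \<cdot> r) (q \<cdot> r)"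
    unfolding difunctional_def
  proof (intro ballI allI impI)
    fix T x y u v assume T: "T \<in> Obj C"
    let ?E = "elt_rel C R (p \<cdot> r) (q \<cdot> r) T" and ?S = "elt_rel C S (p1 \<cdot> s) (p2 \<cdot> s) T"
    assume *: "(x, u) \<in> ?E \<and> (y, u) \<in> ?E \<and> (y, v) \<in> ?E"
    \<comment> \<open>The three given pairs are elements \<open>a\<close>, \<open>b\<close>,
      \<open>c\<close> of \<open>R\<close>. Then \<open>a S b\<close> says that \<open>x\<close> is
      related to \<open>u\<close>, \<open>b S c\<close> that \<open>y\<close> is related to
      \<open>v\<close>, and \<open>a S c\<close> is the claim.\<close>
    obtain a where a: "a \<in> hom C T R" "p \<cdot> r \<cdot> a = x"
      using * unfolding elt_rel_def by auto
    obtain b where b: "b \<in> hom C T R" "p \<cdot> r \<cdot> b = y" "q \<cdot> r \<cdot> b = u"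
      using * unfolding elt_rel_def by auto
    obtain c where c: "c \<in> hom C T R" "q \<cdot> r \<cdot> c = v"
      using * unfolding elt_rel_def by auto
    have "(a, b) \<in> ?S" "(b, c) \<in> ?S"
      using elt a b c * by simp_all
    moreover have "trans ?S"
      using reflexive_imp_equivalence[OF S] T by (auto simp: equivalence_relation_def equiv_def)
    ultimately have "(a, c) \<in> ?S"
      by (blast dest: transD)
    then show "(x, v) \<in> ?E"
      using elt a c by simp
  qed
qed

lemma (in strongly_unital) strongly_unital_imp_unital: "unital C"
proof (intro unital.intro unital_axioms.intro finitely_complete_axioms pointed_axioms)
  fix X Y P p q k l
  assume P: "product C X Y P p q"
    and k: "k \<in> hom C X P" "p \<cdot> k = ident C X" "zero_arrow C X Y (q \<cdot> k)"
    and l: "l \<in> hom C Y P" "zero_arrow C Y X (p \<cdot> l)" "q \<cdot> l = ident C Y"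
  note pr = productD[OF P]
  note k1 = hom_arrD[OF k(1)] note l1 = hom_arrD[OF l(1)]
  show "jointly_extremally_epic C k l P"
    unfolding jointly_extremally_epic_def
  proof (intro allI impI)
    fix m assume *: "monic C m \<and> cod C m = P \<and> factors_through C k m \<and> factors_through C l m"
    let ?R = "dom C m"
    have m: "m \<in> Arr C" "cod C m = P" using * by (auto simp: monic_def)
    obtain a where a: "a \<in> Arr C" "dom C a = X" "cod C a = ?R" "m \<cdot> a = k"
      using * k1(2) factors_throughE by metis
    obtain b where b: "b \<in> Arr C" "dom C b = Y" "cod C b = ?R" "m \<cdot> b = l"
      using * l1(2) factors_throughE by metis
    have rel: "relation C X Y P p q ?R m"
      using P * m by (simp add: relation_def hom_def)
    obtain Q p1 p2 S s where S: "reflexive_relation C ?R Q p1 p2 S s"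
      and elt: "\<And>T a b. (a, b) \<in> elt_rel C S (p1 \<cdot> s) (p2 \<cdot> s) T \<longleftrightarrow>
         a \<in> hom C T ?R \<and> b \<in> hom C T ?R \<and> (p \<cdot> m \<cdot> a, q \<cdot> m \<cdot> b) \<in> elt_rel C ?R (p \<cdot> m) (q \<cdot> m) T"
      using shear_relation[OF rel] by blast
    note sl = relationD[OF reflexive_relationD(1)[OF S]]
    note qr = productD[OF sl(1)]
    \<comment> \<open>The zero endomorphism of \<open>?R\<close>, routed through \<open>a\<close> so
      that its first leg is \<open>(p \<cdot> l) \<cdot> (q \<cdot> m)\<close>. This arrow and
      \<open>q \<cdot> m\<close> are the legs of \<open>b \<cdot> (q \<cdot> m)\<close>, so
      \<open>S\<close> relates \<open>?z\<close> to the identity: it is right punctual.\<close>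
    let ?z = "a \<cdot> ((p \<cdot> l) \<cdot> (q \<cdot> m))"
    have z: "zero_arrow C ?R ?R ?z"
      by (rule zero_arrow_comp_left[OF zero_arrow_comp_right[OF l(2)]])
        (use a m pr in \<open>auto simp: hom_def cat_simps\<close>)
    have z1: "?z \<in> hom C ?R ?R" by (rule zero_arrow_hom[OF z])
    have "(?z, ident C ?R) \<in> elt_rel C S (p1 \<cdot> s) (p2 \<cdot> s) ?R"
      unfolding elt
    proof (intro conjI z1)
      show "ident C ?R \<in> hom C ?R ?R"
        using m by (intro ident_hom) (simp add: cat_simps)
      show "(p \<cdot> m \<cdot> ?z, q \<cdot> m \<cdot> ident C ?R) \<in> elt_rel C ?R (p \<cdot> m) (q \<cdot> m) ?R"
        by (rule elt_relI[of "b \<cdot> (q \<cdot> m)"])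
          (use a b m pr k1 l1 in \<open>simp_all add: cat_simps comp_reassoc[OF a(4)] comp_reassoc[OF b(4)]
            comp_reassoc[OF k(2)] comp_reassoc[OF l(3)]\<close>)
    qed
    then obtain h where h: "h \<in> Arr C" "dom C h = ?R" "cod C h = S"
      "(p1 \<cdot> s) \<cdot> h = ?z" "(p2 \<cdot> s) \<cdot> h = ident C ?R"
      by (rule elt_relE)
    have "right_punctual C ?R Q p1 p2 s"
      unfolding right_punctual_def
    proof (intro bexI conjI)
      show "s \<cdot> h \<in> hom C ?R Q"
        using h sl by (simp add: hom_def cat_simps)
      have "p1 \<cdot> (s \<cdot> h) = ?z"
        using h(1-3) sl qr by (simp add: assoc flip: h(4))
      then show "zero_arrow C ?R ?R (p1 \<cdot> (s \<cdot> h))" using z by simp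
      show "p2 \<cdot> (s \<cdot> h) = ident C ?R"
        using h(1-3) sl qr by (simp add: assoc flip: h(5))
      show "factors_through C (s \<cdot> h) s"
        using h sl unfolding factors_through_def by (intro bexI[of _ h]) (simp_all add: hom_def cat_simps)
    qed
    then have "iso C s"
      by (rule right_punctual_reflexive_total[OF S])
    then obtain t where t: "t \<in> Arr C" "dom C t = Q" "cod C t = S" "s \<cdot> t = ident C Q"
      using sl by (auto simp: iso_def hom_def)
    obtain c where c: "c \<in> Arr C" "dom C c = P" "cod C c = Q" "p1 \<cdot> c = a \<cdot> p" "p2 \<cdot> c = b \<cdot> q"
      using product_lift[OF sl(1), of "a \<cdot> p" "b \<cdot> q"] a b pr by (auto simp: cat_simps)
    \<comment> \<open>Being total, \<open>S\<close> relates the axis elements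
      \<open>a \<cdot> p\<close> and \<open>b \<cdot> q\<close>. The first leg of the former is
      \<open>p\<close> and the second leg of the latter is \<open>q\<close>, so the generic pair is
      in the relation.\<close>
    have "(a \<cdot> p, b \<cdot> q) \<in> elt_rel C S (p1 \<cdot> s) (p2 \<cdot> s) P"
      by (rule elt_relI[of "t \<cdot> c"])
        (use c t sl qr in \<open>simp_all add: cat_simps comp_reassoc[OF t(4)]\<close>)
    then have "(p \<cdot> m \<cdot> (a \<cdot> p), q \<cdot> m \<cdot> (b \<cdot> q)) \<in> elt_rel C ?R (p \<cdot> m) (q \<cdot> m) P"
      using elt by blast
    moreover have "p \<cdot> m \<cdot> (a \<cdot> p) = p" "q \<cdot> m \<cdot> (b \<cdot> q) = q"
      using a b m pr k l k1 l1 by (simp_all add: cat_simps comp_reassoc[OF a(4)] comp_reassoc[OF b(4)]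
            comp_reassoc[OF k(2)] comp_reassoc[OF l(3)])
    ultimately show "iso C m"
      using relation_iso_if_total[OF rel] by simp
  qed
qed

section \<open>The fibres of points\<close>

text \<open>The conditions on the underlying arrow, freed from the triples, so that questions about
  a fibre become equations in \<open>C\<close>.\<close>

definition point_arrow :: "('o, 'a) cat \<Rightarrow> 'a \<times> 'a \<Rightarrow> 'a \<Rightarrow> 'a \<times> 'a \<Rightarrow> bool" where
  "point_arrow C A x B \<longleftrightarrow>
     x \<in> hom C (dom C (fst A)) (dom C (fst B)) \<and>
     fst B \<cdot>\<^bsub>C\<^esub> x = fst A \<and> x \<cdot>\<^bsub>C\<^esub> snd A = snd B"

lemma Pt_simps:
  "Obj (Pt C Y) = Pt_obj C Y"
  "ident (Pt C Y) A = (A, ident C (dom C (fst A)), A)"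
  "(b', y, c) \<cdot>\<^bsub>Pt C Y\<^esub> (a, x, b) = (a, y \<cdot>\<^bsub>C\<^esub> x, c)"
  "dom (Pt C Y) (a, x, b) = a"
  "cod (Pt C Y) (a, x, b) = b"
  by (simp_all add: Pt_def split: prod.split)

lemma Pt_objD:
  assumes "A \<in> Pt_obj C Y"
  shows "fst A \<in> Arr C" "snd A \<in> Arr C" "cod C (fst A) = Y" "dom C (snd A) = Y"
    "cod C (snd A) = dom C (fst A)" "fst A \<cdot>\<^bsub>C\<^esub> snd A = ident C Y"
  using assms by (auto simp: Pt_obj_def hom_def)

lemma Pt_objI:
  "f \<in> Arr C \<Longrightarrow> s \<in> Arr C \<Longrightarrow> cod C f = Y \<Longrightarrow> dom C s = Y \<Longrightarrow> cod C s = dom C f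
    \<Longrightarrow> f \<cdot>\<^bsub>C\<^esub> s = ident C Y \<Longrightarrow> (f, s) \<in> Pt_obj C Y"
  by (auto simp: Pt_obj_def hom_def)

lemma Arr_Pt_iff:
  "(A, x, B) \<in> Arr (Pt C Y) \<longleftrightarrow> A \<in> Pt_obj C Y \<and> B \<in> Pt_obj C Y \<and> point_arrow C A x B"
  by (cases A; cases B) (auto simp: Pt_def Pt_arr_def point_arrow_def)

lemma hom_Pt_iff:
  "(A', x, B') \<in> hom (Pt C Y) A B \<longleftrightarrow>
     A' = A \<and> B' = B \<and> A \<in> Pt_obj C Y \<and> B \<in> Pt_obj C Y \<and> point_arrow C A x B"
  by (auto simp: hom_def Arr_Pt_iff Pt_simps)

lemma hom_PtE:
  assumes "t \<in> hom (Pt C Y) A B"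
  obtains x where "t = (A, x, B)" "A \<in> Pt_obj C Y" "B \<in> Pt_obj C Y" "point_arrow C A x B"
  using assms by (cases t) (auto simp: hom_Pt_iff)

lemma point_arrowD:
  assumes "point_arrow C A x B"
  shows "x \<in> Arr C" "dom C x = dom C (fst A)" "cod C x = dom C (fst B)"
    "fst B \<cdot>\<^bsub>C\<^esub> x = fst A" "x \<cdot>\<^bsub>C\<^esub> snd A = snd B"
  using assms by (auto simp: point_arrow_def hom_def)

lemma point_arrowI:
  "x \<in> Arr C \<Longrightarrow> dom C x = dom C (fst A) \<Longrightarrow> cod C x = dom C (fst B) \<Longrightarrow>
    fst B \<cdot>\<^bsub>C\<^esub> x = fst A \<Longrightarrow> x \<cdot>\<^bsub>C\<^esub> snd A = snd B \<Longrightarrow> point_arrow C A x B"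
  by (auto simp: point_arrow_def hom_def)

section \<open>The fibres as pointed categories\<close>

context category
begin

lemma point_arrow_comp:
  assumes "A \<in> Pt_obj C Y" "D \<in> Pt_obj C Y" "point_arrow C A x B" "point_arrow C B y D"
  shows "point_arrow C A (y \<cdot> x) D"
proof (rule point_arrowI)
  note A = Pt_objD[OF assms(1)] note D = Pt_objD[OF assms(2)]
  note x = point_arrowD[OF assms(3)] note y = point_arrowD[OF assms(4)]
  show "y \<cdot> x \<in> Arr C" "dom C (y \<cdot> x) = dom C (fst A)" "cod C (y \<cdot> x) = dom C (fst D)"
    using x y by (simp_all add: comp_arr)
  show "fst D \<cdot> (y \<cdot> x) = fst A" "y \<cdot> x \<cdot> snd A = snd D"
    using A D x y by (simp_all add: assoc comp_reassoc[OF y(4)])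
qed

lemma point_arrow_ident:
  assumes "A \<in> Pt_obj C Y"
  shows "point_arrow C A (ident C (dom C (fst A))) A"
  using Pt_objD[OF assms] by (intro point_arrowI) (simp_all add: cat_simps)

text \<open>Factorisations found in \<open>C\<close> are arrows of points for free. The projection
  is respected because \<open>x\<close> alone respects it; the section is respected because
  \<open>h \<cdot> snd A\<close> and \<open>snd B\<close> agree after \<open>x\<close> and after
  \<open>y\<close>.\<close>

lemma point_arrow_lift:
  assumes A: "A \<in> Pt_obj C Y" and B: "B \<in> Pt_obj C Y" and D: "D \<in> Pt_obj C Y"
    and jm: "jointly_monic C x y" and x: "point_arrow C B x D" and y: "point_arrow C B y F"
    and h: "h \<in> Arr C" "dom C h = dom C (fst A)" "cod C h = dom C x"
    and xh: "point_arrow C A (x \<cdot> h) D" and yh: "point_arrow C A (y \<cdot> h) F"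
  shows "point_arrow C A h B"
proof (rule point_arrowI)
  note a = Pt_objD[OF A] note b = Pt_objD[OF B] note d = Pt_objD[OF D]
  note x1 = point_arrowD[OF x] note y1 = point_arrowD[OF y]
  note xh1 = point_arrowD(5)[OF xh] note yh1 = point_arrowD(5)[OF yh]
  show "fst B \<cdot> h = fst A"
    using comp_reassoc[OF x1(4), of h] h x1(1-3) d point_arrowD(4)[OF xh] by simp
  show "h \<cdot> snd A = snd B"
  proof (rule jointly_monicD[OF jm])
    show "x \<cdot> (h \<cdot> snd A) = x \<cdot> snd B" "y \<cdot> (h \<cdot> snd A) = y \<cdot> snd B"
      using assoc[of "snd A" h x] assoc[of "snd A" h y] h x1 y1 a xh1 yh1 by simp_all
  qed (use h x1 a b in \<open>simp_all add: comp_arr\<close>)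
qed (use h point_arrowD[OF x] in auto)

lemma category_Pt: "category (Pt C Y)"
proof
  fix t assume "t \<in> Arr (Pt C Y)"
  then show "dom (Pt C Y) t \<in> Obj (Pt C Y)" "cod (Pt C Y) t \<in> Obj (Pt C Y)"
    by (cases t; simp add: Arr_Pt_iff Pt_simps)+
next
  fix A assume "A \<in> Obj (Pt C Y)"
  then show "ident (Pt C Y) A \<in> hom (Pt C Y) A A"
    using point_arrow_ident by (simp add: Pt_simps hom_Pt_iff)
next
  fix t u A B D assume t: "t \<in> hom (Pt C Y) A B" and u: "u \<in> hom (Pt C Y) B D"
  obtain x where x: "t = (A, x, B)" "A \<in> Pt_obj C Y" "point_arrow C A x B"
    using hom_PtE[OF t] by metis
  obtain y where y: "u = (B, y, D)" "D \<in> Pt_obj C Y" "point_arrow C B y D"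
    using hom_PtE[OF u] by metis
  show "u \<cdot>\<^bsub>Pt C Y\<^esub> t \<in> hom (Pt C Y) A D"
    using x y point_arrow_comp by (simp add: Pt_simps hom_Pt_iff)
next
  fix t A B assume t: "t \<in> hom (Pt C Y) A B"
  obtain x where x: "t = (A, x, B)" "point_arrow C A x B"
    using hom_PtE[OF t] by metis
  then show "ident (Pt C Y) B \<cdot>\<^bsub>Pt C Y\<^esub> t = t" "t \<cdot>\<^bsub>Pt C Y\<^esub> ident (Pt C Y) A = t"
    using point_arrowD[OF x(2)] by (simp_all add: Pt_simps cat_simps)
next
  fix t u v A B D F
  assume t: "t \<in> hom (Pt C Y) A B" and u: "u \<in> hom (Pt C Y) B D" and v: "v \<in> hom (Pt C Y) D F"
  obtain x where x: "t = (A, x, B)" "point_arrow C A x B"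
    using hom_PtE[OF t] by metis
  obtain y where y: "u = (B, y, D)" "point_arrow C B y D"
    using hom_PtE[OF u] by metis
  obtain z where z: "v = (D, z, F)" "point_arrow C D z F"
    using hom_PtE[OF v] by metis
  show "v \<cdot>\<^bsub>Pt C Y\<^esub> (u \<cdot>\<^bsub>Pt C Y\<^esub> t) = (v \<cdot>\<^bsub>Pt C Y\<^esub> u) \<cdot>\<^bsub>Pt C Y\<^esub> t"
    using point_arrowD[OF x(2)] point_arrowD[OF y(2)] point_arrowD[OF z(2)] x y z
    by (simp add: Pt_simps assoc)
qed

text \<open>The section condition forces an arrow from \<open>?Z\<close> to \<open>A\<close> to be
  \<open>snd A\<close>; the projection condition forces an arrow back to be
  \<open>fst A\<close>.\<close>

lemma zero_object_Pt:
  assumes "Y \<in> Obj C"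
  shows "zero_object (Pt C Y) (ident C Y, ident C Y)"
proof -
  let ?Z = "(ident C Y, ident C Y)"
  have Z: "?Z \<in> Pt_obj C Y"
    using assms by (intro Pt_objI) (simp_all add: cat_simps)
  have "(\<exists>!t. t \<in> hom (Pt C Y) ?Z A) \<and> (\<exists>!t. t \<in> hom (Pt C Y) A ?Z)" if A: "A \<in> Pt_obj C Y" for A
  proof (intro conjI ex1I)
    note a = Pt_objD[OF A]
    show "(?Z, snd A, A) \<in> hom (Pt C Y) ?Z A" "(A, fst A, ?Z) \<in> hom (Pt C Y) A ?Z"
      using A Z a assms by (auto simp: hom_Pt_iff cat_simps intro!: point_arrowI)
    show "t = (?Z, snd A, A)" if "t \<in> hom (Pt C Y) ?Z A" for t
      using that
    proof (rule hom_PtE)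
      fix x assume t: "t = (?Z, x, A)" "point_arrow C ?Z x A"
      show ?thesis
        using point_arrowD[OF t(2)] t(1) assms by (simp add: cat_simps)
    qed
    show "t = (A, fst A, ?Z)" if "t \<in> hom (Pt C Y) A ?Z" for t
      using that
    proof (rule hom_PtE)
      fix x assume t: "t = (A, x, ?Z)" "point_arrow C A x ?Z"
      show ?thesis
        using point_arrowD[OF t(2)] t(1) assms by (simp add: cat_simps)
    qed
  qed
  then show ?thesis
    using Z by (simp add: zero_object_def Pt_simps)
qed

lemma pointed_Pt: "Y \<in> Obj C \<Longrightarrow> pointed (Pt C Y)"
  using zero_object_Pt category_Pt by (auto intro!: pointed.intro pointed_axioms.intro)

lemma zero_arrow_Pt:
  assumes "A \<in> Pt_obj C Y" "B \<in> Pt_obj C Y" "x = snd B \<cdot> fst A"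
  shows "zero_arrow (Pt C Y) A B (A, x, B)"
proof -
  let ?Z = "(ident C Y, ident C Y)"
  note a = Pt_objD[OF assms(1)] note b = Pt_objD[OF assms(2)]
  have Y: "Y \<in> Obj C" using a cod_obj by blast
  have Z: "zero_object (Pt C Y) ?Z" by (rule zero_object_Pt[OF Y])
  then have "?Z \<in> Pt_obj C Y" by (simp add: zero_object_def Pt_simps)
  then have "(A, fst A, ?Z) \<in> hom (Pt C Y) A ?Z" "(?Z, snd B, B) \<in> hom (Pt C Y) ?Z B"
    using assms Y a b by (auto simp: hom_Pt_iff cat_simps intro!: point_arrowI)
  then show ?thesis
    using Z assms(3) unfolding zero_arrow_def by (force simp: Pt_simps)
qed

end

section \<open>Finite limits in the fibres\<close>

text \<open>The shape \<open>J\<close> with a terminal object adjoined: the new object and its identity are \<open>0\<close>, an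
  object \<open>j\<close> of \<open>J\<close> becomes \<open>j + 1\<close>, an arrow \<open>u\<close> of \<open>J\<close> becomes \<open>2 u + 1\<close>, and \<open>2 j + 2\<close> is
  the arrow from \<open>j\<close> to the new object.\<close>

definition terminal_shape :: "(nat, nat) cat \<Rightarrow> (nat, nat) cat" where
  "terminal_shape J = \<lparr>
     Obj = insert 0 (Suc ` Obj J),
     Arr = insert 0 ((\<lambda>u. Suc (2 * u)) ` Arr J \<union> (\<lambda>j. Suc (Suc (2 * j))) ` Obj J),
     dom = (\<lambda>n. if odd n then Suc (dom J (n div 2)) else n div 2),
     cod = (\<lambda>n. if odd n then Suc (cod J (n div 2)) else 0),
     ident = (\<lambda>n. case n of 0 \<Rightarrow> 0 | Suc j \<Rightarrow> Suc (2 * ident J j)),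
     comp = (\<lambda>v u. if odd v then Suc (2 * (v div 2 \<cdot>\<^bsub>J\<^esub> (u div 2)))
       else if v = 0 then u else Suc (Suc (2 * dom J (u div 2))))\<rparr>"

lemma category_terminal_shape:
  assumes "category J"
  shows "category (terminal_shape J)"
proof -
  interpret J: category J by (fact assms)
  show ?thesis
    by (unfold_locales; auto simp: terminal_shape_def hom_def J.cat_simps)
qed

context finitely_complete
begin

text \<open>The projections of the points extend a diagram by the vertex \<open>Y\<close>. A cone
  over the extended diagram has a leg to \<open>Y\<close>, which makes its vertex an object over
  \<open>Y\<close> even for an empty or disconnected shape. The sections form a cone too, and this
  yields the section of the limit.\<close>

lemma finitely_complete_Pt:
  assumes Y: "Y \<in> Obj C"
  shows "finitely_complete (Pt C Y)"
proof (intro finitely_complete.intro finitely_complete_axioms.intro category_Pt)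
  fix J :: "(nat, nat) cat" and Fo Fa
  assume J: "category J" "finite (Obj J)" "finite (Arr J)" and F: "functor J (Pt C Y) Fo Fa"
  interpret J: category J by (fact J(1))
  define x where "x u = fst (snd (Fa u))" for u
  have Fo: "Fo j \<in> Pt_obj C Y" if "j \<in> Obj J" for j
    using F that by (simp add: functor_def Pt_simps)
  have Fa: "Fa u = (Fo (dom J u), x u, Fo (cod J u)) \<and> point_arrow C (Fo (dom J u)) (x u) (Fo (cod J u))"
    if "u \<in> Arr J" for u
    using F that by (auto simp: functor_def x_def elim!: ballE[of _ _ u] hom_PtE)
  have Fid: "x (ident J j) = ident C (dom C (fst (Fo j)))" if "j \<in> Obj J" for j
    using F that by (simp add: functor_def x_def Pt_simps)
  have Fcomp: "x (v \<cdot>\<^bsub>J\<^esub> u) = x v \<cdot> x u" if "u \<in> Arr J" "v \<in> Arr J" "dom J v = cod J u" for u v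
  proof -
    have "Fa (v \<cdot>\<^bsub>J\<^esub> u) = Fa v \<cdot>\<^bsub>Pt C Y\<^esub> Fa u"
      using F that by (simp add: functor_def)
    then show ?thesis
      using Fa that J.comp_arr by (simp add: Pt_simps)
  qed
  note pt = Fo[THEN Pt_objD(1)] Fo[THEN Pt_objD(2)] Fo[THEN Pt_objD(3)] Fo[THEN Pt_objD(4)]
    Fo[THEN Pt_objD(5)] Fo[THEN Pt_objD(6)]
  have xa: "x u \<in> Arr C" "dom C (x u) = dom C (fst (Fo (dom J u)))"
    "cod C (x u) = dom C (fst (Fo (cod J u)))" "fst (Fo (cod J u)) \<cdot> x u = fst (Fo (dom J u))"
    "x u \<cdot> snd (Fo (dom J u)) = snd (Fo (cod J u))" if "u \<in> Arr J" for u
    using point_arrowD[OF conjunct2[OF Fa[OF that]]] by auto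
  let ?J = "terminal_shape J"
  \<comment> \<open>An even code \<open>2 j + 2\<close> stands for the arrow from \<open>j\<close>
    to the new object and is sent to the projection of \<open>Fo j\<close>. Half of it is
    \<open>j + 1\<close>, whence the \<open>- 1\<close>.\<close>
  let ?Go = "\<lambda>n. case n of 0 \<Rightarrow> Y | Suc j \<Rightarrow> dom C (fst (Fo j))"
  let ?Ga = "\<lambda>n. if n = 0 then ident C Y else if odd n then x (n div 2) else fst (Fo (n div 2 - 1))"
  have "functor ?J C ?Go ?Ga"
    using Y by (auto simp: functor_def terminal_shape_def hom_def cat_simps pt xa Fid Fcomp
        J.dom_obj J.cod_obj J.ident_arr)
  moreover have "finite (Obj ?J)" "finite (Arr ?J)"
    using J by (simp_all add: terminal_shape_def)
  ultimately obtain L \<pi> where L: "limit_cone ?J C ?Go ?Ga L \<pi>"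
    using finite_limits[OF category_terminal_shape[OF J(1)]] by blast
  have cone: "cone ?J C ?Go ?Ga M \<mu> \<longleftrightarrow> \<mu> 0 \<in> hom C M Y \<and>
      (\<forall>j \<in> Obj J. \<mu> (Suc j) \<in> hom C M (dom C (fst (Fo j))) \<and> fst (Fo j) \<cdot> \<mu> (Suc j) = \<mu> 0) \<and>
      (\<forall>u \<in> Arr J. x u \<cdot> \<mu> (Suc (dom J u)) = \<mu> (Suc (cod J u)))" for M \<mu>
    using hom_objD(1)[of "\<mu> 0" M Y]
    by (auto simp: cone_def terminal_shape_def hom_def ident_comp ball_Un)
  have cL: "\<pi> 0 \<in> hom C L Y" "\<And>j. j \<in> Obj J \<Longrightarrow> \<pi> (Suc j) \<in> hom C L (dom C (fst (Fo j)))"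
    "\<And>j. j \<in> Obj J \<Longrightarrow> fst (Fo j) \<cdot> \<pi> (Suc j) = \<pi> 0"
    "\<And>u. u \<in> Arr J \<Longrightarrow> x u \<cdot> \<pi> (Suc (dom J u)) = \<pi> (Suc (cod J u))"
    using L cone[of L \<pi>] by (auto simp: limit_cone_def)
  have lim: "\<exists>!h. h \<in> hom C M L \<and> \<pi> 0 \<cdot> h = \<mu> 0 \<and> (\<forall>j \<in> Obj J. \<pi> (Suc j) \<cdot> h = \<mu> (Suc j))"
    if "cone ?J C ?Go ?Ga M \<mu>" for M \<mu>
  proof -
    have "\<exists>!h. h \<in> hom C M L \<and> (\<forall>j \<in> Obj ?J. \<pi> j \<cdot> h = \<mu> j)"
      using L that by (simp add: limit_cone_def)
    then show ?thesis by (simp add: terminal_shape_def)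
  qed
  \<comment> \<open>The cone of sections, with the identity as its leg to the adjoined vertex; that
    leg makes the induced \<open>t\<close> a section of \<open>\<pi> 0\<close>.\<close>
  define \<sigma> where "\<sigma> n = (case n of 0 \<Rightarrow> ident C Y | Suc j \<Rightarrow> snd (Fo j))" for n
  have "cone ?J C ?Go ?Ga Y \<sigma>"
    unfolding cone using Y by (simp add: \<sigma>_def hom_def cat_simps pt xa)
  from ex1_implies_ex[OF lim[OF this]] obtain t where t: "t \<in> hom C Y L" "\<pi> 0 \<cdot> t = ident C Y"
    "\<And>j. j \<in> Obj J \<Longrightarrow> \<pi> (Suc j) \<cdot> t = snd (Fo j)"
    by (auto simp: \<sigma>_def)
  let ?L = "(\<pi> 0, t)" and ?\<pi> = "\<lambda>j. ((\<pi> 0, t), \<pi> (Suc j), Fo j)"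
  have dL: "dom C (\<pi> 0) = L" using cL(1) by (simp add: hom_def)
  have L_obj: "?L \<in> Pt_obj C Y"
    using cL(1) t by (auto simp: Pt_obj_def hom_def)
  have "limit_cone J (Pt C Y) Fo Fa ?L ?\<pi>"
    unfolding limit_cone_def
  proof (intro conjI allI impI)
    show "cone J (Pt C Y) Fo Fa ?L ?\<pi>"
      unfolding cone_def
      using L_obj Fo cL t Fa by (simp add: Pt_simps hom_Pt_iff point_arrow_def dL)
    fix M \<mu> assume M: "cone J (Pt C Y) Fo Fa M \<mu>"
    define m where "m j = fst (snd (\<mu> j))" for j
    have M_obj: "M \<in> Pt_obj C Y"
      using M by (simp add: cone_def Pt_simps)
    note Ma = Pt_objD[OF M_obj]
    have \<mu>: "\<mu> j = (M, m j, Fo j) \<and> point_arrow C M (m j) (Fo j)" if "j \<in> Obj J" for j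
      using M that by (auto simp: cone_def m_def elim!: ballE[of _ _ j] hom_PtE)
    have ma: "m j \<in> Arr C" "dom C (m j) = dom C (fst M)" "cod C (m j) = dom C (fst (Fo j))"
      "fst (Fo j) \<cdot> m j = fst M" "m j \<cdot> snd M = snd (Fo j)" if "j \<in> Obj J" for j
      using point_arrowD[OF conjunct2[OF \<mu>[OF that]]] by auto
    have mx: "x u \<cdot> m (dom J u) = m (cod J u)" if "u \<in> Arr J" for u
    proof -
      have "Fa u \<cdot>\<^bsub>Pt C Y\<^esub> \<mu> (dom J u) = \<mu> (cod J u)"
        using M that by (simp add: cone_def)
      then show ?thesis
        using Fa \<mu> that J.dom_obj J.cod_obj by (simp add: Pt_simps)
    qed
    define \<nu> where "\<nu> n = (case n of 0 \<Rightarrow> fst M | Suc j \<Rightarrow> m j)" for n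
    have "cone ?J C ?Go ?Ga (dom C (fst M)) \<nu>"
      unfolding cone using ma mx Ma by (simp add: \<nu>_def hom_def)
    from lim[OF this] have ex: "\<exists>!h. h \<in> hom C (dom C (fst M)) L \<and> \<pi> 0 \<cdot> h = fst M \<and>
        (\<forall>j \<in> Obj J. \<pi> (Suc j) \<cdot> h = m j)"
      by (simp add: \<nu>_def)
    then obtain h where h: "h \<in> hom C (dom C (fst M)) L" "\<pi> 0 \<cdot> h = fst M"
      "\<And>j. j \<in> Obj J \<Longrightarrow> \<pi> (Suc j) \<cdot> h = m j"
      by auto
    \<comment> \<open>Both sides factor the cone \<open>\<sigma>\<close> of sections through the
      limit.\<close>
    have "h \<cdot> snd M = t"
    proof -
      have "cone ?J C ?Go ?Ga Y \<sigma>" by fact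
      from lim[OF this] have "\<exists>!h. h \<in> hom C Y L \<and> \<pi> 0 \<cdot> h = ident C Y \<and>
          (\<forall>j \<in> Obj J. \<pi> (Suc j) \<cdot> h = snd (Fo j))"
        by (simp add: \<sigma>_def)
      moreover have "h \<cdot> snd M \<in> hom C Y L"
        using h(1) Ma by (simp add: hom_def comp_arr)
      moreover have "\<pi> 0 \<cdot> (h \<cdot> snd M) = ident C Y"
        using comp_reassoc[OF h(2)] h(1) cL(1) Ma by (simp add: hom_def)
      moreover have "\<pi> (Suc j) \<cdot> (h \<cdot> snd M) = snd (Fo j)" if "j \<in> Obj J" for j
        using comp_reassoc[OF h(3)[OF that]] h(1) cL(2)[OF that] Ma ma(5)[OF that] by (simp add: hom_def)
      ultimately show ?thesis using t by blast
    qed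
    then have hp: "point_arrow C M h ?L"
      using h dL by (simp add: point_arrow_def)
    show "\<exists>!k. k \<in> hom (Pt C Y) M ?L \<and> (\<forall>j \<in> Obj J. ?\<pi> j \<cdot>\<^bsub>Pt C Y\<^esub> k = \<mu> j)"
    proof (intro ex1I conjI)
      show "(M, h, ?L) \<in> hom (Pt C Y) M ?L"
        using hp M_obj L_obj by (simp add: hom_Pt_iff)
      show "\<forall>j \<in> Obj J. ?\<pi> j \<cdot>\<^bsub>Pt C Y\<^esub> (M, h, ?L) = \<mu> j"
        using \<mu> h by (simp add: Pt_simps)
      fix k assume k: "k \<in> hom (Pt C Y) M ?L \<and> (\<forall>j \<in> Obj J. ?\<pi> j \<cdot>\<^bsub>Pt C Y\<^esub> k = \<mu> j)"
      then obtain h' where h': "k = (M, h', ?L)" "point_arrow C M h' ?L"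
        using hom_PtE by metis
      have "h' \<in> hom C (dom C (fst M)) L" "\<pi> 0 \<cdot> h' = fst M"
        using h'(2) dL by (simp_all add: point_arrow_def)
      moreover have "\<forall>j \<in> Obj J. \<pi> (Suc j) \<cdot> h' = m j"
        using k h'(1) \<mu> by (simp add: Pt_simps)
      ultimately show "k = (M, h, ?L)"
        using ex h h' by blast
    qed
  qed
  then show "\<exists>L \<pi>. limit_cone J (Pt C Y) Fo Fa L \<pi>" by blast
qed

section \<open>Transfer of difunctionality to the fibres\<close>

text \<open>The kernel pair in \<open>C\<close> of two arrows of a fibre again lies in the fibre.\<close>

lemma jointly_monic_Pt:
  assumes "jointly_monic (Pt C Y) (A, x, B) (A, y, D)"
  shows "jointly_monic C x y"
proof -
  have arr: "A \<in> Pt_obj C Y" "B \<in> Pt_obj C Y" "D \<in> Pt_obj C Y" "point_arrow C A x B" "point_arrow C A y D"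
    using assms by (auto simp: jointly_monic_def Arr_Pt_iff)
  note A = Pt_objD[OF arr(1)] note B = Pt_objD[OF arr(2)]
  note x = point_arrowD[OF arr(4)] note y = point_arrowD[OF arr(5)]
  obtain P p q where P: "product C (dom C (fst B)) (dom C (fst D)) P p q"
    using product_exists dom_obj Pt_objD(1) arr by metis
  note pr = productD[OF P]
  obtain w where w: "w \<in> Arr C" "dom C w = dom C (fst A)" "cod C w = P" "p \<cdot> w = x" "q \<cdot> w = y"
    using product_lift[OF P x(1) y(1)] x y by auto
  obtain K k1 k2 where K: "pullback C w w K k1 k2"
    using pullback_exists w by metis
  note kr = pullbackD[OF K]
  \<comment> \<open>\<open>K\<close> consists of the pairs that neither \<open>x\<close> nor
    \<open>y\<close> separates. Its section is the diagonal at \<open>snd A\<close>.\<close>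
  obtain t where t: "t \<in> Arr C" "dom C t = Y" "cod C t = K" "k1 \<cdot> t = snd A" "k2 \<cdot> t = snd A"
    using pullback_lift[OF K A(2) A(2)] A w by auto
  have xk: "x \<cdot> k1 = x \<cdot> k2" "y \<cdot> k1 = y \<cdot> k2"
    using kr w(1-3) pr by (simp_all add: assoc flip: w(4,5))
  \<comment> \<open>Since \<open>fst A\<close> is \<open>fst B \<cdot> x\<close>, both legs lie over
    the same arrow to \<open>Y\<close>, so both are arrows of points for one projection of
    \<open>K\<close>.\<close>
  have Ak: "fst A \<cdot> k2 = fst A \<cdot> k1"
    using comp_reassoc[OF x(4), of k1] comp_reassoc[OF x(4), of k2] xk kr B x(1-3) w(2) by simp
  let ?K = "(fst A \<cdot> k1, t)"
  have K_obj: "?K \<in> Pt_obj C Y"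
    using A kr t w by (intro Pt_objI) (simp_all add: cat_simps)
  have "(?K, k1, A) \<in> hom (Pt C Y) ?K A" "(?K, k2, A) \<in> hom (Pt C Y) ?K A"
    using K_obj arr A kr t w Ak by (auto simp: hom_Pt_iff cat_simps intro!: point_arrowI)
  moreover have "(A, x, B) \<cdot>\<^bsub>Pt C Y\<^esub> (?K, k1, A) = (A, x, B) \<cdot>\<^bsub>Pt C Y\<^esub> (?K, k2, A)"
    "(A, y, D) \<cdot>\<^bsub>Pt C Y\<^esub> (?K, k1, A) = (A, y, D) \<cdot>\<^bsub>Pt C Y\<^esub> (?K, k2, A)"
    using xk by (simp_all add: Pt_simps)
  ultimately have "(?K, k1, A) = (?K, k2, A)"
    using assms unfolding jointly_monic_def Pt_simps(4) by blast
  \<comment> \<open>The equality of the legs, proved by cancelling in the fibre, holds in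
    \<open>C\<close>. Any two arrows of \<open>C\<close> not separated by \<open>x\<close> and
    \<open>y\<close> are the legs after a single \<open>h\<close>, hence equal.\<close>
  then have k12: "k1 = k2" by simp
  show ?thesis
    unfolding jointly_monic_def
  proof (intro conjI allI ballI impI)
    show "x \<in> Arr C" "y \<in> Arr C" "dom C x = dom C y"
      using x y by auto
    fix T a b assume ab: "a \<in> hom C T (dom C x)" "b \<in> hom C T (dom C x)"
      and eq: "x \<cdot> a = x \<cdot> b \<and> y \<cdot> a = y \<cdot> b"
    note ab = hom_arrD[OF ab(1)] hom_arrD[OF ab(2)]
    have "w \<cdot> a = w \<cdot> b"
    proof (rule jointly_monicD[OF product_jointly_monic[OF P]])
      show "p \<cdot> (w \<cdot> a) = p \<cdot> (w \<cdot> b)" "q \<cdot> (w \<cdot> a) = q \<cdot> (w \<cdot> b)"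
        using eq ab w pr x by (simp_all add: comp_reassoc[OF w(4)] comp_reassoc[OF w(5)])
    qed (use ab w pr x in \<open>simp_all add: comp_arr\<close>)
    then obtain h where "k1 \<cdot> h = a" "k2 \<cdot> h = b"
      using pullback_lift[OF K ab(1,4)] ab w x by auto
    then show "a = b" using k12 by simp
  qed
qed

text \<open>An element at stage \<open>T\<close> in the fibre is in particular an element in
  \<open>C\<close> at the underlying object of \<open>T\<close>. Difunctionality in \<open>C\<close>
  yields the witness there, and \<open>point_arrow_lift\<close> makes it an arrow of points.\<close>

lemma difunctional_jointly_monic_Pt:
  assumes dif: "relations_difunctional C" and jm: "jointly_monic (Pt C Y) (A, x, B) (A, y, D)"
  shows "difunctional (Pt C Y) A (A, x, B) (A, y, D)"
proof -
  have arr: "A \<in> Pt_obj C Y" "B \<in> Pt_obj C Y" "D \<in> Pt_obj C Y" "point_arrow C A x B" "point_arrow C A y D"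
    using jm by (auto simp: jointly_monic_def Arr_Pt_iff)
  note A = Pt_objD[OF arr(1)] note B = Pt_objD[OF arr(2)]
  note x = point_arrowD[OF arr(4)] note y = point_arrowD[OF arr(5)]
  have jmC: "jointly_monic C x y" by (rule jointly_monic_Pt[OF jm])
  have elt: "(a, b) \<in> elt_rel (Pt C Y) A (A, x, B) (A, y, D) T \<longleftrightarrow>
    (\<exists>h. T \<in> Pt_obj C Y \<and> point_arrow C T h A \<and> a = (T, x \<cdot> h, B) \<and> b = (T, y \<cdot> h, D))"
    (is "_ \<longleftrightarrow> (\<exists>h. ?P h)") for a b T
  proof
    assume "(a, b) \<in> elt_rel (Pt C Y) A (A, x, B) (A, y, D) T"
    then obtain t where "t \<in> hom (Pt C Y) T A" "a = (A, x, B) \<cdot>\<^bsub>Pt C Y\<^esub> t" "b = (A, y, D) \<cdot>\<^bsub>Pt C Y\<^esub> t"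
      unfolding elt_rel_def by blast
    then show "\<exists>h. ?P h"
      by (elim hom_PtE) (auto simp: Pt_simps)
  next
    assume "\<exists>h. ?P h"
    then obtain h where "?P h" ..
    then show "(a, b) \<in> elt_rel (Pt C Y) A (A, x, B) (A, y, D) T"
      unfolding elt_rel_def using arr(1)
      by (intro CollectI exI[of _ "(T, h, A)"]) (simp add: Pt_simps hom_Pt_iff)
  qed
  show ?thesis
    unfolding difunctional_def
  proof (intro ballI allI impI)
    fix T a b c d
    let ?E = "elt_rel (Pt C Y) A (A, x, B) (A, y, D) T"
    assume *: "(a, c) \<in> ?E \<and> (b, c) \<in> ?E \<and> (b, d) \<in> ?E"
    obtain h1 where h1: "T \<in> Pt_obj C Y" "point_arrow C T h1 A" "a = (T, x \<cdot> h1, B)" "c = (T, y \<cdot> h1, D)"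
      using * elt by blast
    obtain h2 where h2: "point_arrow C T h2 A" "b = (T, x \<cdot> h2, B)" "c = (T, y \<cdot> h2, D)"
      using * elt by blast
    obtain h3 where h3: "point_arrow C T h3 A" "b = (T, x \<cdot> h3, B)" "d = (T, y \<cdot> h3, D)"
      using * elt by blast
    note T = Pt_objD[OF h1(1)]
    note p1 = point_arrowD[OF h1(2)] note p2 = point_arrowD[OF h2(1)] note p3 = point_arrowD[OF h3(1)]
    let ?T = "dom C (fst T)"
    let ?F = "elt_rel C (dom C x) x y ?T"
    have "(x \<cdot> h1, y \<cdot> h1) \<in> ?F" "(x \<cdot> h2, y \<cdot> h2) \<in> ?F" "(x \<cdot> h3, y \<cdot> h3) \<in> ?F"
      using elt_relI[OF _ _ _ refl refl, of h1] elt_relI[OF _ _ _ refl refl, of h2]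
        elt_relI[OF _ _ _ refl refl, of h3] p1 p2 p3 x by simp_all
    moreover have "y \<cdot> h1 = y \<cdot> h2" "x \<cdot> h2 = x \<cdot> h3"
      using h1 h2 h3 by auto
    ultimately have "(x \<cdot> h1, y \<cdot> h3) \<in> ?F"
      using difunctionalD[OF difunctional_jointly_monic[OF dif jmC]] dom_obj[OF T(1)] by metis
    then obtain h where h: "h \<in> Arr C" "dom C h = ?T" "cod C h = dom C x" "x \<cdot> h = x \<cdot> h1" "y \<cdot> h = y \<cdot> h3"
      by (rule elt_relE)
    have "point_arrow C T (x \<cdot> h) B" "point_arrow C T (y \<cdot> h) D"
      unfolding h(4,5) using point_arrow_comp arr h1(1,2) h3(1) by blast+
    then have "point_arrow C T h A"
      by (rule point_arrow_lift[OF h1(1) arr(1,2) jmC arr(4,5) h(1-3)])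
    then show "(a, d) \<in> ?E"
      using elt h h1 h3 by metis
  qed
qed

lemma relations_difunctional_Pt:
  assumes "relations_difunctional C"
  shows "relations_difunctional (Pt C Y)"
  unfolding relations_difunctional_def
proof (intro allI impI)
  interpret Pt: category "Pt C Y" by (rule category_Pt)
  fix A B P p q R r assume rel: "relation (Pt C Y) A B P p q R r"
  have r: "r \<in> hom (Pt C Y) R P" using rel by (simp add: relation_def)
  note pq = Pt.product_homD[OF Pt.relationD(1)[OF rel]]
  obtain x where x: "p \<cdot>\<^bsub>Pt C Y\<^esub> r = (R, x, A)"
    using Pt.comp_hom[OF r pq(1)] by (rule hom_PtE)
  obtain y where y: "q \<cdot>\<^bsub>Pt C Y\<^esub> r = (R, y, B)"
    using Pt.comp_hom[OF r pq(2)] by (rule hom_PtE)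
  show "difunctional (Pt C Y) R (p \<cdot>\<^bsub>Pt C Y\<^esub> r) (q \<cdot>\<^bsub>Pt C Y\<^esub> r)"
    using difunctional_jointly_monic_Pt[OF assms] Pt.relation_jointly_monic[OF rel]
    unfolding x y by blast
qed

end

section \<open>From unital fibres to difunctionality\<close>

context category
begin

text \<open>Arrows from a point \<open>T\<close> to \<open>A\<close> and \<open>B\<close> agree over
  \<open>Y\<close>, as both composites are \<open>fst T\<close>, so they lift to the pullback; the
  lift respects sections by \<open>point_arrow_lift\<close>.\<close>

lemma product_Pt:
  assumes A: "A \<in> Pt_obj C Y" and B: "B \<in> Pt_obj C Y"
    and P: "pullback C (fst A) (fst B) P p q"
    and t: "t \<in> hom C Y P" "p \<cdot> t = snd A" "q \<cdot> t = snd B"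
  shows "product (Pt C Y) A B (fst A \<cdot> p, t)
    ((fst A \<cdot> p, t), p, A) ((fst A \<cdot> p, t), q, B)"
proof -
  let ?P = "(fst A \<cdot> p, t)"
  note a = Pt_objD[OF A] note b = Pt_objD[OF B] note pb = pullbackD[OF P] note t1 = hom_arrD[OF t(1)]
  have P_obj: "?P \<in> Pt_obj C Y"
    using a pb(1-10) t t1 by (intro Pt_objI) (simp_all add: cat_simps)
  have pp: "point_arrow C ?P p A" and qq: "point_arrow C ?P q B"
    using a b pb t t1 by (auto simp: comp_arr intro!: point_arrowI)
  show ?thesis
    unfolding product_def Pt_simps
  proof (intro conjI A B P_obj ballI)
    show "(?P, p, A) \<in> hom (Pt C Y) ?P A" "(?P, q, B) \<in> hom (Pt C Y) ?P B"
      using A B P_obj pp qq by (simp_all add: hom_Pt_iff)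
    fix T u v assume T: "T \<in> Pt_obj C Y"
      and u: "u \<in> hom (Pt C Y) T A" and v: "v \<in> hom (Pt C Y) T B"
    obtain x where x: "u = (T, x, A)" "point_arrow C T x A" using hom_PtE[OF u] by metis
    obtain y where y: "v = (T, y, B)" "point_arrow C T y B" using hom_PtE[OF v] by metis
    note xr = point_arrowD[OF x(2)] note yr = point_arrowD[OF y(2)]
    obtain h where h: "h \<in> Arr C" "dom C h = dom C x" "cod C h = P" "p \<cdot> h = x" "q \<cdot> h = y"
      using pullback_lift[OF P xr(1) yr(1)] xr yr by auto
    have "point_arrow C T h ?P"
      by (rule point_arrow_lift[OF T P_obj A pullback_jointly_monic[OF P] pp qq])
        (use h xr x(2) y(2) pb A P_obj in simp_all)
    then have hT: "(T, h, ?P) \<in> hom (Pt C Y) T ?P"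
      using T P_obj by (simp add: hom_Pt_iff)
    show "\<exists>!w. w \<in> hom (Pt C Y) T ?P \<and> (?P, p, A) \<cdot>\<^bsub>Pt C Y\<^esub> w = u \<and> (?P, q, B) \<cdot>\<^bsub>Pt C Y\<^esub> w = v"
    proof (rule ex1I)
      show "(T, h, ?P) \<in> hom (Pt C Y) T ?P \<and> (?P, p, A) \<cdot>\<^bsub>Pt C Y\<^esub> (T, h, ?P) = u \<and>
          (?P, q, B) \<cdot>\<^bsub>Pt C Y\<^esub> (T, h, ?P) = v"
        using hT h x y by (simp add: Pt_simps)
      fix w assume w: "w \<in> hom (Pt C Y) T ?P \<and> (?P, p, A) \<cdot>\<^bsub>Pt C Y\<^esub> w = u \<and> (?P, q, B) \<cdot>\<^bsub>Pt C Y\<^esub> w = v"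
      then obtain k where k: "w = (T, k, ?P)" "point_arrow C T k ?P" using hom_PtE by metis
      have "p \<cdot> k = p \<cdot> h" "q \<cdot> k = q \<cdot> h"
        using w k(1) h x y by (simp_all add: Pt_simps)
      then have "k = h"
        by (rule jointly_monicD[OF pullback_jointly_monic[OF P], rotated -2])
          (use point_arrowD[OF k(2)] h xr pb in \<open>simp_all add: comp_arr\<close>)
      then show "w = (T, h, ?P)" using k by simp
    qed
  qed
qed

lemma monic_Pt:
  assumes "A \<in> Pt_obj C Y" "B \<in> Pt_obj C Y" "point_arrow C A m B" "monic C m"
  shows "monic (Pt C Y) (A, m, B)"
  unfolding monic_def
proof (intro conjI ballI impI)
  show "(A, m, B) \<in> Arr (Pt C Y)" using assms by (simp add: Arr_Pt_iff)
  fix T g h assume g: "g \<in> hom (Pt C Y) T (dom (Pt C Y) (A, m, B))"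
    and h: "h \<in> hom (Pt C Y) T (dom (Pt C Y) (A, m, B))"
    and eq: "(A, m, B) \<cdot>\<^bsub>Pt C Y\<^esub> g = (A, m, B) \<cdot>\<^bsub>Pt C Y\<^esub> h"
  obtain x where x: "g = (T, x, A)" "point_arrow C T x A"
    using g unfolding Pt_simps by (rule hom_PtE) blast
  obtain y where y: "h = (T, y, A)" "point_arrow C T y A"
    using h unfolding Pt_simps by (rule hom_PtE) blast
  have "x = y"
    by (rule monicD[OF assms(4)])
      (use point_arrowD[OF x(2)] point_arrowD[OF y(2)] point_arrowD[OF assms(3)] eq x(1) y(1)
        in \<open>simp_all add: Pt_simps\<close>)
  then show "g = h" using x y by simp
qed

end

context finitely_complete
begin

text \<open>For legs \<open>f, g\<close> of a relation on \<open>R\<close>, the kernel pairs of \<open>g\<close> and \<open>f\<close> are points over \<open>R\<close>.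
  Their product in the fibre consists of triples \<open>(a, b, c)\<close> with \<open>g a = g b\<close> and \<open>f b = f c\<close>, and
  difunctionality says that the subobject \<open>W\<close> of those triples with \<open>f a\<close> related to \<open>g c\<close> is
  everything. It contains the triples \<open>(a, b, b)\<close> and \<open>(b, b, c)\<close>.\<close>

lemma unital_Pt_imp_difunctional:
  assumes unital: "unital (Pt C R)" and rel: "relation C X Y Z z z' R r"
  shows "difunctional C R (z \<cdot> r) (z' \<cdot> r)"
proof -
  note rl = relationD[OF rel]
  note pr = productD[OF rl(1)]
  define f where "f = z \<cdot> r" define g where "g = z' \<cdot> r"
  have f: "f \<in> Arr C" "dom C f = R" "cod C f = X" and g: "g \<in> Arr C" "dom C g = R" "cod C g = Y"
    using rl pr by (simp_all add: f_def g_def comp_arr)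
  have jm: "jointly_monic C f g"
    unfolding f_def g_def by (rule relation_jointly_monic[OF rel])
  have R: "R \<in> Obj C" by (rule rl)
  obtain G g1 g2 where G: "pullback C g g G g1 g2" using pullback_exists[OF g(1) g(1)] by auto
  obtain F f1 f2 where F: "pullback C f f F f1 f2" using pullback_exists[OF f(1) f(1)] by auto
  note Gr = pullbackD[OF G] note Fr = pullbackD[OF F]
  obtain dg where dg: "dg \<in> Arr C" "dom C dg = R" "cod C dg = G" "g1 \<cdot> dg = ident C R" "g2 \<cdot> dg = ident C R"
    using pullback_lift[OF G, of "ident C R" "ident C R"] R g by (auto simp: cat_simps)
  obtain df where df: "df \<in> Arr C" "dom C df = R" "cod C df = F" "f1 \<cdot> df = ident C R" "f2 \<cdot> df = ident C R"
    using pullback_lift[OF F, of "ident C R" "ident C R"] R f by (auto simp: cat_simps)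
  \<comment> \<open>The projections are the second leg for \<open>G\<close> and the first leg for
    \<open>F\<close>, so that the pullback over \<open>R\<close> glues \<open>(a, b)\<close> and
    \<open>(b, c)\<close> along \<open>b\<close>.\<close>
  let ?A = "(g2, dg)" and ?B = "(f1, df)"
  have A: "?A \<in> Pt_obj C R" using Gr dg g by (intro Pt_objI) simp_all
  have B: "?B \<in> Pt_obj C R" using Fr df f by (intro Pt_objI) simp_all
  obtain P u v where P: "pullback C g2 f1 P u v"
    using pullback_exists[of g2 f1] Gr Fr f g by auto
  note Pr = pullbackD[OF P]
  obtain t where t: "t \<in> Arr C" "dom C t = R" "cod C t = P" "u \<cdot> t = dg" "v \<cdot> t = df"
    using pullback_lift[OF P dg(1) df(1)] dg df Gr Fr by auto
  let ?P = "(g2 \<cdot> u, t)"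
  have prod: "product (Pt C R) ?A ?B ?P (?P, u, ?A) (?P, v, ?B)"
    using product_Pt[OF A B, of P u v t] P t by (simp add: hom_def)
  then have P_obj: "?P \<in> Pt_obj C R" by (simp add: product_def Pt_simps)
  \<comment> \<open>\<open>w\<close> sends \<open>(a, b, c)\<close> to the pair
    \<open>(f a, g c)\<close>; \<open>W\<close> is the inverse image of the relation along
    it.\<close>
  obtain w where w: "w \<in> Arr C" "dom C w = P" "cod C w = Z" "z \<cdot> w = f \<cdot> (g1 \<cdot> u)" "z' \<cdot> w = g \<cdot> (f2 \<cdot> v)"
    using product_lift[OF rl(1), of "f \<cdot> (g1 \<cdot> u)" "g \<cdot> (f2 \<cdot> v)"] f g Gr Fr Pr by (auto simp: comp_arr)
  obtain W m n where W: "pullback C w r W m n"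
    using pullback_exists[OF w(1) rl(3)] w rl by auto
  note Wr = pullbackD[OF W]
  have m_monic: "monic C m" by (rule pullback_monic[OF W rl(2)])
  have zw: "z \<cdot> (w \<cdot> a) = f \<cdot> (g1 \<cdot> (u \<cdot> a))" "z' \<cdot> (w \<cdot> a) = g \<cdot> (f2 \<cdot> (v \<cdot> a))"
    if "a \<in> Arr C" "cod C a = P" for a
    using that f g w(1-3) pr Gr(1-10) Fr(1-10) Pr(1-10)
    by (simp_all add: comp_reassoc[OF w(4)] comp_reassoc[OF w(5)] comp_arr assoc)
  have zr: "z \<cdot> (r \<cdot> b) = f \<cdot> b" "z' \<cdot> (r \<cdot> b) = g \<cdot> b" if "b \<in> Arr C" "cod C b = R" for b
    unfolding f_def g_def using that rl pr by (simp_all add: assoc)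
  \<comment> \<open>Membership in \<open>W\<close>: it is enough to exhibit an element
    \<open>b\<close> of \<open>R\<close> with the two outer legs of the triple.\<close>
  have W_lift: "\<exists>h. h \<in> Arr C \<and> dom C h = dom C a \<and> cod C h = W \<and> m \<cdot> h = a"
    if a: "a \<in> Arr C" "cod C a = P" and b: "b \<in> Arr C" "cod C b = R" "dom C b = dom C a"
      and eqs: "f \<cdot> (g1 \<cdot> (u \<cdot> a)) = f \<cdot> b" "g \<cdot> (f2 \<cdot> (v \<cdot> a)) = g \<cdot> b" for a b
  proof -
    have "z \<cdot> (w \<cdot> a) = z \<cdot> (r \<cdot> b)" "z' \<cdot> (w \<cdot> a) = z' \<cdot> (r \<cdot> b)"
      using zw zr a b eqs by simp_all
    then have "w \<cdot> a = r \<cdot> b"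
      by (rule jointly_monicD[OF product_jointly_monic[OF rl(1)], rotated -2])
        (use a b w(1-3) pr rl in \<open>simp_all add: comp_arr\<close>)
    then show ?thesis
      using pullback_lift[OF W a(1) b(1)] a b w(2) rl by metis
  qed
  obtain s where s: "s \<in> Arr C" "dom C s = R" "cod C s = W" "m \<cdot> s = t"
    using W_lift[of t "ident C R"] t dg df R f g by (auto simp: cat_simps)
  let ?W = "(g2 \<cdot> (u \<cdot> m), s)"
  have W_obj: "?W \<in> Pt_obj C R"
    using Wr(1-10) Pr(1-10) Gr(1-10) w(2) s t dg f g
    by (intro Pt_objI) (simp_all add: cat_simps)
  have m_point: "point_arrow C ?W m ?P"
    using Wr(1-10) Pr(1-10) Gr(1-10) w(2) s by (intro point_arrowI) (simp_all add: cat_simps)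
  let ?m = "(?W, m, ?P)"
  have m_Pt: "monic (Pt C R) ?m"
    by (rule monic_Pt[OF W_obj P_obj m_point m_monic])
  have factors: "factors_through (Pt C R) (D, a, ?P) ?m"
    if D: "D \<in> Pt_obj C R" and a: "point_arrow C D a ?P" and h: "h \<in> Arr C" "dom C h = dom C a" "cod C h = W" "m \<cdot> h = a"
    for D a h
  proof -
    \<comment> \<open>The monic \<open>m\<close>, paired with itself, serves as the jointly monic
      pair of \<open>point_arrow_lift\<close>.\<close>
    have "jointly_monic C m m"
      using m_monic Wr hom_objD(1) unfolding jointly_monic_def monic_def by metis
    then have "point_arrow C D h ?W"
      by (rule point_arrow_lift[OF D W_obj P_obj _ m_point m_point])
        (use point_arrowD[OF a] h Wr a P_obj W_obj in simp_all)
    then show ?thesis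
      unfolding factors_through_def Pt_simps using D W_obj h
      by (intro bexI[of _ "(D, h, ?W)"]) (simp_all add: Pt_simps hom_Pt_iff)
  qed
  \<comment> \<open>\<open>k\<close> is \<open>(a, b) \<mapsto> (a, b, b)\<close> and
    \<open>l\<close> below is \<open>(b, c) \<mapsto> (b, b, c)\<close>. Their composites
    \<open>df \<cdot> g2\<close> and \<open>dg \<cdot> f1\<close> with the other projection are a
    section after a projection, hence zero arrows of the fibre.\<close>
  obtain k where k: "k \<in> Arr C" "dom C k = G" "cod C k = P" "u \<cdot> k = ident C G" "v \<cdot> k = df \<cdot> g2"
    using pullback_lift[OF P, of "ident C G" "df \<cdot> g2"] Gr Fr df f g by (auto simp: cat_simps comp_reassoc[OF df(4)])
  obtain l where l: "l \<in> Arr C" "dom C l = F" "cod C l = P" "u \<cdot> l = dg \<cdot> f1" "v \<cdot> l = ident C F"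
    using pullback_lift[OF P, of "dg \<cdot> f1" "ident C F"] Gr Fr dg f g by (auto simp: cat_simps comp_reassoc[OF dg(5)])
  note uv_jm = jointly_monicD[OF pullback_jointly_monic[OF P], rotated -2]
  have "k \<cdot> dg = t"
    by (rule uv_jm) (use k t dg df Gr Pr(1-10) f g in
      \<open>simp_all add: cat_simps comp_reassoc[OF k(4)] comp_reassoc[OF k(5)]\<close>)
  then have k_point: "point_arrow C ?A k ?P"
    using k Gr Pr(1-10) f g by (intro point_arrowI) (simp_all add: cat_simps)
  have "l \<cdot> df = t"
    by (rule uv_jm) (use l t dg df Fr Pr(1-10) f g in
      \<open>simp_all add: cat_simps comp_reassoc[OF l(4)] comp_reassoc[OF l(5)]\<close>)
  then have l_point: "point_arrow C ?B l ?P"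
    using l Gr Fr Pr(1-10) f g dg by (intro point_arrowI) (simp_all add: cat_simps comp_reassoc[OF dg(5)])
  have "factors_through (Pt C R) (?A, k, ?P) ?m"
  proof -
    have "\<exists>h. h \<in> Arr C \<and> dom C h = dom C k \<and> cod C h = W \<and> m \<cdot> h = k"
      \<comment> \<open>On \<open>(a, b, b)\<close> the witness is \<open>a\<close>, because
        \<open>g b = g a\<close>.\<close>
      by (rule W_lift[of k g1]) (use k Gr Fr df f g in \<open>simp_all add: cat_simps comp_reassoc[OF df(5)]\<close>)
    then show ?thesis using factors[OF A k_point] by blast
  qed
  moreover have "factors_through (Pt C R) (?B, l, ?P) ?m"
  proof -
    have "\<exists>h. h \<in> Arr C \<and> dom C h = dom C l \<and> cod C h = W \<and> m \<cdot> h = l"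
      \<comment> \<open>On \<open>(b, b, c)\<close> the witness is \<open>c\<close>, because
        \<open>f b = f c\<close>.\<close>
      by (rule W_lift[of l f2]) (use l Gr Fr dg f g in \<open>simp_all add: cat_simps comp_reassoc[OF dg(4)]\<close>)
    then show ?thesis using factors[OF B l_point] by blast
  qed
  moreover have "jointly_extremally_epic (Pt C R) (?A, k, ?P) (?B, l, ?P) ?P"
  proof (rule unital.injections_jointly_extremally_epic[OF unital prod])
    show "(?A, k, ?P) \<in> hom (Pt C R) ?A ?P" "(?B, l, ?P) \<in> hom (Pt C R) ?B ?P"
      using A B P_obj k_point l_point by (simp_all add: hom_Pt_iff)
    show "(?P, u, ?A) \<cdot>\<^bsub>Pt C R\<^esub> (?A, k, ?P) = ident (Pt C R) ?A"
      "(?P, v, ?B) \<cdot>\<^bsub>Pt C R\<^esub> (?B, l, ?P) = ident (Pt C R) ?B"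
      using k l Gr Fr by (simp_all add: Pt_simps)
    show "zero_arrow (Pt C R) ?A ?B ((?P, v, ?B) \<cdot>\<^bsub>Pt C R\<^esub> (?A, k, ?P))"
      "zero_arrow (Pt C R) ?B ?A ((?P, u, ?A) \<cdot>\<^bsub>Pt C R\<^esub> (?B, l, ?P))"
      unfolding Pt_simps by (rule zero_arrow_Pt[OF A B] zero_arrow_Pt[OF B A]; simp add: k l)+
  qed
  ultimately have "iso (Pt C R) ?m"
    using m_Pt unfolding jointly_extremally_epic_def by (simp add: Pt_simps)
  then obtain i where i: "i \<in> Arr C" "dom C i = P" "cod C i = W" "m \<cdot> i = ident C P"
  proof -
    obtain j where j: "j \<in> hom (Pt C R) ?P ?W" "?m \<cdot>\<^bsub>Pt C R\<^esub> j = ident (Pt C R) ?P"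
      using \<open>iso (Pt C R) ?m\<close> by (auto simp: iso_def Pt_simps(4,5))
    obtain i where i: "j = (?P, i, ?W)" "point_arrow C ?P i ?W"
      using hom_PtE[OF j(1)] by metis
    show ?thesis
      by (rule that[of i]) (use point_arrowD[OF i(2)] j(2) i(1) Wr(1-10) Pr(1-10) Gr(1-10) w(2)
        in \<open>simp_all add: Pt_simps comp_arr\<close>)
  qed
  show ?thesis
    unfolding difunctional_def f_def[symmetric] g_def[symmetric]
  proof (intro ballI allI impI)
    fix T a b c d
    let ?E = "elt_rel C R f g T"
    assume *: "(a, c) \<in> ?E \<and> (b, c) \<in> ?E \<and> (b, d) \<in> ?E"
    obtain h1 where h1: "h1 \<in> Arr C" "dom C h1 = T" "cod C h1 = R" "f \<cdot> h1 = a" "g \<cdot> h1 = c"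
      using * elt_relE by blast
    obtain h2 where h2: "h2 \<in> Arr C" "dom C h2 = T" "cod C h2 = R" "f \<cdot> h2 = b" "g \<cdot> h2 = c"
      using * elt_relE by blast
    obtain h3 where h3: "h3 \<in> Arr C" "dom C h3 = T" "cod C h3 = R" "f \<cdot> h3 = b" "g \<cdot> h3 = d"
      using * elt_relE by blast
    obtain e1 where e1: "e1 \<in> Arr C" "dom C e1 = T" "cod C e1 = G" "g1 \<cdot> e1 = h1" "g2 \<cdot> e1 = h2"
      using pullback_lift[OF G h1(1) h2(1)] h1 h2 g by auto
    obtain e2 where e2: "e2 \<in> Arr C" "dom C e2 = T" "cod C e2 = F" "f1 \<cdot> e2 = h2" "f2 \<cdot> e2 = h3"
      using pullback_lift[OF F h2(1) h3(1)] h2 h3 f by auto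
    obtain e where e: "e \<in> Arr C" "dom C e = T" "cod C e = P" "u \<cdot> e = e1" "v \<cdot> e = e2"
      using pullback_lift[OF P e1(1) e2(1)] e1 e2 Gr Fr by auto
    \<comment> \<open>The triple \<open>e\<close> of the three witnesses lies in \<open>W\<close>
      through the inverse \<open>i\<close> of \<open>m\<close>, and \<open>n\<close> reads off the
      element of \<open>R\<close> that relates its outer legs.\<close>
    let ?n = "n \<cdot> (i \<cdot> e)"
    have "r \<cdot> ?n = w \<cdot> (m \<cdot> (i \<cdot> e))"
      using comp_reassoc[OF Wr(11)[symmetric], of "i \<cdot> e"] assoc[of "i \<cdot> e" m w] Wr(1-10) i(1-3) e(1-3) w(2)
      by (simp add: comp_arr)
    also have "\<dots> = w \<cdot> e"
      using comp_reassoc[OF i(4), of e] i(1-3) e(1-3) Wr(1-10) w(2) by (simp add: ident_comp)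
    finally have rn: "r \<cdot> ?n = w \<cdot> e" .
    have n: "?n \<in> Arr C" "dom C ?n = T" "cod C ?n = R"
      using Wr(1-10) i(1-3) e(1-3) rl by (simp_all add: comp_arr)
    have "f \<cdot> ?n = a"
      using rn zr(1)[OF n(1,3)] zw(1)[OF e(1,3)] e e1 h1 by simp
    moreover have "g \<cdot> ?n = d"
      using rn zr(2)[OF n(1,3)] zw(2)[OF e(1,3)] e e2 h3 by simp
    ultimately show "(a, d) \<in> ?E"
      by (rule elt_relI[OF n])
  qed
qed

end

theorem theorem23:
  fixes E :: "('o, 'a) cat"
  assumes "finitely_complete E"
  shows "((\<forall>Y \<in> Obj E. unital (Pt E Y)) \<longleftrightarrow>
            (\<forall>X Y P p q R r. relation E X Y P p q R r \<longrightarrow>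
               difunctional E R (p \<cdot>\<^bsub>E\<^esub> r) (q \<cdot>\<^bsub>E\<^esub> r))) \<and>
         ((\<forall>X Y P p q R r. relation E X Y P p q R r \<longrightarrow>
               difunctional E R (p \<cdot>\<^bsub>E\<^esub> r) (q \<cdot>\<^bsub>E\<^esub> r)) \<longleftrightarrow>
            malcev E) \<and>
         (malcev E \<longleftrightarrow> (\<forall>Y \<in> Obj E. strongly_unital (Pt E Y)))"
proof -
  interpret finitely_complete E by (fact assms)
  \<comment> \<open>The fibre that matters is the one over the object carrying the relation.\<close>
  have unital_difunctional: "relations_difunctional E" if "\<forall>Y \<in> Obj E. unital (Pt E Y)"
    unfolding relations_difunctional_def
    using that unital_Pt_imp_difunctional relationD(6) by metis
  have difunctional_unital: "unital (Pt E Y)" "strongly_unital (Pt E Y)"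
    if "relations_difunctional E" "Y \<in> Obj E" for Y
    using finitely_complete.difunctional_imp_unital finitely_complete.difunctional_imp_strongly_unital
      finitely_complete_Pt relations_difunctional_Pt pointed_Pt that by blast+
  \<comment> \<open>This implication holds fibre by fibre and closes the cycle from strongly unital
    fibres back to unital ones.\<close>
  have strongly_unital_unital: "unital (Pt E Y)" if "strongly_unital (Pt E Y)" for Y
    by (rule strongly_unital.strongly_unital_imp_unital[OF that])
  have malcev_difunctional: "malcev E \<longleftrightarrow> relations_difunctional E"
    using malcev.malcev_imp_difunctional difunctional_imp_reflexive_equivalence
      malcev.intro[OF assms malcev_axioms.intro] by blast
  show ?thesis
    unfolding relations_difunctional_def[symmetric]
    using unital_difunctional difunctional_unital strongly_unital_unital malcev_difunctional by blast
qed

end
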